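(* Let $d\ge1$ and $\varepsilon\in(0,1)$ with $\varepsilon^{-1}\in\mathbb N$. For all $u_0^\varepsilon,v_0^\varepsilon\in\mathbb R^{\mathbb T_\varepsilon^d}$ and $t>0$, letting $(u_t^\varepsilon)_{t\ge0}$ and $(v_t^\varepsilon)_{t\ge0}$ be the averaging processes on $\mathbb T_\varepsilon^d$ started from $u_0^\varepsilon$ and $v_0^\varepsilon$, respectively, and driven by the same Poisson processes, we have $$\varepsilon^d\sum_{x\in\mathbb T_\varepsilon^d}\sum_{j=1}^d\Big|\mathbb E\big[\nabla^{\varepsilon,j}u_t^\varepsilon(x)\,\nabla^{\varepsilon,j}v_t^\varepsilon(x)\big]\Big|\le2\,\Big(\max_{i=1,\dots,d}\|\nabla^{\varepsilon,i}u_0^\varepsilon\|_{L^\infty(\mathbb T_\varepsilon^d)}\Big)\Big(\sum_{i=1}^d\|\nabla^{\varepsilon,i}v_0^\varepsilon\|_{L^1(\mathbb T_\varepsilon^d)}\Big).$$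
   Context: $\mathbb T_\varepsilon^d=(\varepsilon\mathbb Z/\mathbb Z)^d$ is the discrete torus with mesh $\varepsilon$; $e_1,\dots,e_d$ is the canonical basis. Let $(N_t^{\varepsilon,i}(x))_{t\ge0}$, $x\in\mathbb T_\varepsilon^d$, $i=1,\dots,d$, be i.i.d. Poisson processes of intensity $\varepsilon^{-2}$, with expectation $\mathbb E$. The averaging process started from a deterministic $u_0^\varepsilon$ is the càdlàg process which, at each arrival time $t$ of $N^{\varepsilon,i}(x)$, replaces both $u_{t^-}^\varepsilon(x)$ and $u_{t^-}^\varepsilon(x+\varepsilon e_i)$ with $\tfrac12(u_{t^-}^\varepsilon(x)+u_{t^-}^\varepsilon(x+\varepsilon e_i))$, leaves the other values unchanged, and is constant between arrivals. $\nabla^{\varepsilon,i}h(x)=\varepsilon^{-1}(h(x+\varepsilon e_i)-h(x))$; $\|h\|_{L^1(\mathbb T_\varepsilon^d)}=\varepsilon^d\sum_{x\in\mathbb T_\varepsilon^d}|h(x)|$; $\|h\|_{L^\infty(\mathbb T_\varepsilon^d)}=\sup_{x\in\mathbb T_\varepsilon^d}|h(x)|$. *)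

theory Defs
  imports "HOL-Probability.Probability"
begin

section \<open>The discrete torus\<close>

text \<open>
  The torus \<open>(\<epsilon>\<int>/\<int>)\<^sup>d\<close>, with \<open>d = CARD('d)\<close>, is represented by its representatives in
  \<open>[0,1)\<^sup>d\<close>; sums of points are reduced modulo 1 in every coordinate.  Functions on the torus
  are total functions of which only the values on \<open>torus \<epsilon>\<close> matter.
\<close>

definition torus :: "real \<Rightarrow> (real ^ 'd) set" where
  "torus \<epsilon> = {x. \<forall>j. 0 \<le> x $ j \<and> x $ j < 1 \<and> (\<exists>k::int. x $ j = \<epsilon> * of_int k)}"

definition shift :: "real \<Rightarrow> 'd \<Rightarrow> real ^ 'd \<Rightarrow> real ^ 'd" where
  "shift \<epsilon> i x = (\<chi> j. frac ((x + \<epsilon> *\<^sub>R axis i 1) $ j))"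

definition grad :: "real \<Rightarrow> 'd \<Rightarrow> (real ^ 'd \<Rightarrow> real) \<Rightarrow> real ^ 'd \<Rightarrow> real" where
  "grad \<epsilon> i h x = (h (shift \<epsilon> i x) - h x) / \<epsilon>"

definition L1_norm :: "real \<Rightarrow> (real ^ 'd \<Rightarrow> real) \<Rightarrow> real" where
  "L1_norm \<epsilon> h = \<epsilon> ^ CARD('d) * (\<Sum>x\<in>torus \<epsilon>. \<bar>h x\<bar>)"

definition Linf_norm :: "real \<Rightarrow> (real ^ 'd \<Rightarrow> real) \<Rightarrow> real" where
  "Linf_norm \<epsilon> h = (SUP x\<in>torus \<epsilon>. \<bar>h x\<bar>)"

section \<open>Poisson processes\<close>

text \<open>
  The subtraction of counts below is truncated, but almost all paths are nondecreasing on
  \<open>[0,\<infinity>)\<close>.  That almost all jumps have size one follows from the law of the increments.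
\<close>

definition poisson_process :: "'w measure \<Rightarrow> real \<Rightarrow> (real \<Rightarrow> 'w \<Rightarrow> nat) \<Rightarrow> bool" where
  "poisson_process M r N \<longleftrightarrow>
     (\<forall>t\<ge>0. N t \<in> measurable M (count_space UNIV)) \<and>
     (AE \<omega> in M. N 0 \<omega> = 0 \<and> mono_on {0..} (\<lambda>t. N t \<omega>) \<and>
                 (\<forall>t\<ge>0. continuous (at_right t) (\<lambda>s. N s \<omega>))) \<and>
     (\<forall>s t. 0 \<le> s \<and> s < t \<longrightarrow>
        distr M (count_space UNIV) (\<lambda>\<omega>. N t \<omega> - N s \<omega>)
          = measure_pmf (poisson_pmf (r * (t - s)))) \<and>
     (\<forall>(m::nat) \<tau>. 0 \<le> \<tau> 0 \<and> mono \<tau> \<longrightarrow>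
        prob_space.indep_vars M (\<lambda>_. count_space UNIV)
          (\<lambda>k \<omega>. N (\<tau> (Suc k)) \<omega> - N (\<tau> k) \<omega>) {..<m})"

text \<open>Mutual independence is that of whole paths, as elements of the product of copies
  of \<open>\<nat>\<close> indexed by \<open>[0,\<infinity>)\<close>.\<close>

definition iid_poisson_processes ::
    "'w measure \<Rightarrow> real \<Rightarrow> 'k set \<Rightarrow> ('k \<Rightarrow> real \<Rightarrow> 'w \<Rightarrow> nat) \<Rightarrow> bool" where
  "iid_poisson_processes M r K N \<longleftrightarrow>
     (\<forall>k\<in>K. poisson_process M r (N k)) \<and>
     prob_space.indep_vars M (\<lambda>_. \<Pi>\<^sub>M t\<in>{0..}. count_space UNIV)
       (\<lambda>k \<omega>. \<lambda>t\<in>{0..}. N k t \<omega>) K"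

text \<open>For a nondecreasing counting path these are exactly the times at which it jumps.\<close>

definition arrivals :: "(real \<Rightarrow> nat) \<Rightarrow> real set" where
  "arrivals \<nu> = {t. 0 < t \<and> (\<forall>s. 0 \<le> s \<and> s < t \<longrightarrow> \<nu> s < \<nu> t)}"

section \<open>The averaging process\<close>

definition average :: "real \<Rightarrow> 'd \<Rightarrow> real ^ 'd \<Rightarrow> (real ^ 'd \<Rightarrow> real) \<Rightarrow> (real ^ 'd \<Rightarrow> real)" where
  "average \<epsilon> i x h =
     (\<lambda>y. if y = x \<or> y = shift \<epsilon> i x then (h x + h (shift \<epsilon> i x)) / 2 else h y)"

definition cadlag :: "(real \<Rightarrow> real) \<Rightarrow> bool" where
  "cadlag f \<longleftrightarrow>
     (\<forall>t\<ge>0. continuous (at_right t) f) \<and> (\<forall>t>0. \<exists>l. (f \<longlongrightarrow> l) (at_left t))"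

text \<open>Here \<open>\<nu> (x, i)\<close> is a path of the counting process attached to the edge from \<open>x\<close>
  to \<open>shift \<epsilon> i x\<close>.\<close>

definition averaging_path ::
    "real \<Rightarrow> ((real ^ 'd) \<times> 'd \<Rightarrow> real \<Rightarrow> nat) \<Rightarrow> (real ^ 'd \<Rightarrow> real)
       \<Rightarrow> (real \<Rightarrow> real ^ 'd \<Rightarrow> real) \<Rightarrow> bool" where
  "averaging_path \<epsilon> \<nu> u0 u \<longleftrightarrow>
     (\<forall>y\<in>torus \<epsilon>. u 0 y = u0 y) \<and>
     (\<forall>y\<in>torus \<epsilon>. cadlag (\<lambda>t. u t y)) \<and>
     (\<forall>x\<in>torus \<epsilon>. \<forall>i. \<forall>t\<in>arrivals (\<nu> (x, i)). \<forall>y\<in>torus \<epsilon>.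
        u t y = average \<epsilon> i x (\<lambda>z. Lim (at_left t) (\<lambda>s. u s z)) y) \<and>
     (\<forall>s t. 0 \<le> s \<and> s < t \<and> (\<forall>x\<in>torus \<epsilon>. \<forall>i. arrivals (\<nu> (x, i)) \<inter> {s<..t} = {})
        \<longrightarrow> (\<forall>y\<in>torus \<epsilon>. u t y = u s y))"

text \<open>
  The path description can only be met almost surely: on the null event of simultaneous arrivals
  it may be contradictory.  It determines the process up to a null set.
\<close>

definition averaging_process ::
    "'w measure \<Rightarrow> real \<Rightarrow> ((real ^ 'd) \<times> 'd \<Rightarrow> real \<Rightarrow> 'w \<Rightarrow> nat) \<Rightarrow> (real ^ 'd \<Rightarrow> real)
       \<Rightarrow> (real \<Rightarrow> 'w \<Rightarrow> real ^ 'd \<Rightarrow> real) \<Rightarrow> bool" where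
  "averaging_process M \<epsilon> N u0 u \<longleftrightarrow>
     (\<forall>t\<ge>0. \<forall>x\<in>torus \<epsilon>. (\<lambda>\<omega>. u t \<omega> x) \<in> borel_measurable M) \<and>
     (AE \<omega> in M. averaging_path \<epsilon> (\<lambda>k t. N k t \<omega>) u0 (\<lambda>t. u t \<omega>))"

end

theory Submission
  imports Defs
begin

text \<open>
  Averaging along an edge \<open>e\<close> maps \<open>h\<close> to \<open>h - (d\<^sub>e h / 2) f\<^sub>e\<close>, where \<open>d\<^sub>e\<close> is the difference
  along \<open>e\<close> and \<open>f\<^sub>e\<close> the corresponding dipole.  Hence the covariances \<open>g\<^sub>t(e) = \<bbbE>[d\<^sub>e u\<^sub>t d\<^sub>e v\<^sub>t]\<close>
  satisfy a Duhamel formula: \<open>g\<^sub>t\<close> is the product of the differences of the two heat flows, plus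
  \<open>\<integral>\<^sub>0\<^sup>t \<Sum>\<^sub>a (d\<^sub>e P\<^sub>t\<^sub>-\<^sub>s f\<^sub>a)\<^sup>2 g\<^sub>s(a) ds / (4 \<epsilon>\<^sup>2)\<close>.  The heat flow contracts
  the maximum and the \<open>L\<^sup>1\<close> norm of each discrete derivative, and by the energy identity the total
  mass of the nonnegative kernel is at most \<open>1/2\<close>, uniformly in \<open>a\<close>.  By translation invariance
  the kernel, summed over the positions of \<open>e\<close>, depends only on the direction of \<open>a\<close>, so the
  supremum over time can be taken separately in each direction; absorbing it gives the factor \<open>2\<close>.

  Time integrals are avoided by running this argument for the Markov chain that sees at most one
  arrival per time interval of length \<open>t / n\<close>; at time \<open>t\<close> it differs from the averaging process with
  probability \<open>O(1/n)\<close>, and \<open>n\<close> tends to infinity.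
\<close>

section \<open>Averaging along the edges of a translation invariant graph\<close>

text \<open>Working with commuting unit steps \<open>sh i\<close> and with translations
  \<open>tr y\<close> that commute with them and carry \<open>orig\<close> to every vertex keeps the
  argument free of coordinates and of arithmetic modulo 1.\<close>

locale edge_averaging =
  fixes V :: "'v set" and sh :: "'i::finite \<Rightarrow> 'v \<Rightarrow> 'v" and tr :: "'v \<Rightarrow> 'v \<Rightarrow> 'v" and orig :: 'v
  assumes finite_V: "finite V" and orig_V: "orig \<in> V"
    and sh_bij: "bij_betw (sh i) V V"
    and sh_commute: "x \<in> V \<Longrightarrow> sh i (sh j x) = sh j (sh i x)"
    and tr_bij: "y \<in> V \<Longrightarrow> bij_betw (tr y) V V"
    and tr_sh: "y \<in> V \<Longrightarrow> x \<in> V \<Longrightarrow> tr y (sh i x) = sh i (tr y x)"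
    and tr_orig: "y \<in> V \<Longrightarrow> tr y orig = y"
begin

text \<open>Edges are labelled by base point and direction, which keeps the two edges between
  neighbours apart when \<open>sh i\<close> is an involution (\<open>\<epsilon> = 1/2\<close>).\<close>

abbreviation edges :: "('v \<times> 'i) set" where "edges \<equiv> V \<times> UNIV"

definition tgt :: "'v \<times> 'i \<Rightarrow> 'v" where "tgt e = sh (snd e) (fst e)"

definition dif :: "'v \<times> 'i \<Rightarrow> ('v \<Rightarrow> real) \<Rightarrow> real" where
  "dif e h = h (tgt e) - h (fst e)"

definition dip :: "'v \<times> 'i \<Rightarrow> 'v \<Rightarrow> real" where
  "dip e z = of_bool (z = tgt e) - of_bool (z = fst e)"

definition avg :: "'v \<times> 'i \<Rightarrow> ('v \<Rightarrow> real) \<Rightarrow> 'v \<Rightarrow> real" where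
  "avg e h = (\<lambda>y. h y - dif e h / 2 * dip e y)"

text \<open>The expected outcome of one step that averages along each edge with probability
  \<open>p\<close>: an explicit Euler step for half the graph Laplacian, which is written as
  differences against dipoles in view of summation by parts.\<close>

definition heat :: "real \<Rightarrow> ('v \<Rightarrow> real) \<Rightarrow> 'v \<Rightarrow> real" where
  "heat p h = (\<lambda>y. h y - p / 2 * (\<Sum>e\<in>edges. dif e h * dip e y))"

definition nedges :: real where "nedges = real (card edges)"

lemma finite_edges: "finite edges"
  using finite_V by simp

lemma nedges_nonneg: "0 \<le> nedges"
  by (simp add: nedges_def)

section \<open>Averaging along one edge\<close>

lemma sh_V: "x \<in> V \<Longrightarrow> sh i x \<in> V"
  using sh_bij bij_betwE by blast

lemma tgt_V: "e \<in> edges \<Longrightarrow> tgt e \<in> V"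
  by (auto simp: tgt_def sh_V)

lemma abs_dip_le: "\<bar>dip e z\<bar> \<le> 1"
  by (simp add: dip_def)

text \<open>Averaging is the mean of the identity and the swap of the two endpoints. The swap
  permutes \<open>V\<close>, so the maximum and L1 bounds follow from convexity.\<close>

lemma avg_transpose: "avg e h y = (h y + h (Transposition.transpose (fst e) (tgt e) y)) / 2"
  by (auto simp: avg_def dif_def dip_def Transposition.transpose_def field_simps)

lemma transpose_edge_bij: "e \<in> edges \<Longrightarrow> bij_betw (Transposition.transpose (fst e) (tgt e)) V V"
  by (rule bij_betw_byWitness[where f' = "Transposition.transpose (fst e) (tgt e)"])
     (auto simp: Transposition.transpose_def tgt_V split: if_splits)

lemma avg_sup:
  assumes "e \<in> edges" and "\<And>x. x \<in> V \<Longrightarrow> \<bar>h x\<bar> \<le> B" and "y \<in> V"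
  shows "\<bar>avg e h y\<bar> \<le> B"
proof -
  have "Transposition.transpose (fst e) (tgt e) y \<in> V"
    using transpose_edge_bij[OF assms(1)] assms(3) bij_betwE by blast
  then have "\<bar>h y\<bar> \<le> B" "\<bar>h (Transposition.transpose (fst e) (tgt e) y)\<bar> \<le> B"
    using assms by auto
  then show ?thesis unfolding avg_transpose by (simp add: abs_le_iff)
qed

lemma dif_sup:
  assumes "\<And>x. x \<in> V \<Longrightarrow> \<bar>h x\<bar> \<le> B" and "e \<in> edges"
  shows "\<bar>dif e h\<bar> \<le> 2 * B"
  using assms(1)[OF tgt_V[OF assms(2)]] assms(1)[of "fst e"] assms(2)
  by (auto simp: dif_def)

lemma avg_L1:
  assumes "e \<in> edges"
  shows "(\<Sum>y\<in>V. \<bar>avg e h y\<bar>) \<le> (\<Sum>y\<in>V. \<bar>h y\<bar>)"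
proof -
  have "(\<Sum>y\<in>V. \<bar>avg e h y\<bar>)
      \<le> (\<Sum>y\<in>V. \<bar>h y\<bar> / 2 + \<bar>h (Transposition.transpose (fst e) (tgt e) y)\<bar> / 2)"
    unfolding avg_transpose by (intro sum_mono) (simp add: abs_if field_simps)
  also have "\<dots> = (\<Sum>y\<in>V. \<bar>h y\<bar>) / 2 + (\<Sum>y\<in>V. \<bar>h y\<bar>) / 2"
    using sum.reindex_bij_betw[OF transpose_edge_bij[OF assms], of "\<lambda>y. \<bar>h y\<bar>"]
    by (simp add: sum.distrib flip: sum_divide_distrib)
  finally show ?thesis by simp
qed

section \<open>Contraction properties of the heat operator\<close>

lemma heat_convex: "heat p h y = (1 - nedges * p) * h y + p * (\<Sum>e\<in>edges. avg e h y)"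
proof -
  have "(\<Sum>e\<in>edges. avg e h y) = nedges * h y - (\<Sum>e\<in>edges. dif e h * dip e y) / 2"
    by (simp add: avg_def sum_subtractf nedges_def flip: sum_divide_distrib)
  then show ?thesis unfolding heat_def by (simp only:) (simp add: algebra_simps)
qed

context
  fixes p :: real
  assumes p0: "0 \<le> p" and p1: "nedges * p \<le> 1"
begin

text \<open>The weights \<open>1 - nedges * p\<close> and \<open>p\<close>, the latter once per
  edge, are nonnegative and sum to one, so the bound passes to the convex combination.\<close>

lemma heat_sup:
  assumes "\<And>x. x \<in> V \<Longrightarrow> \<bar>h x\<bar> \<le> B" and "y \<in> V"
  shows "\<bar>heat p h y\<bar> \<le> B"
proof -
  have "\<bar>\<Sum>e\<in>edges. avg e h y\<bar> \<le> (\<Sum>e\<in>edges. B)"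
    using avg_sup[OF _ assms(1,2)] by (intro order.trans[OF sum_abs] sum_mono) auto
  then have "\<bar>\<Sum>e\<in>edges. avg e h y\<bar> \<le> nedges * B" by (simp add: nedges_def)
  then have "\<bar>p * (\<Sum>e\<in>edges. avg e h y)\<bar> \<le> p * (nedges * B)"
    using p0 by (simp add: abs_mult mult_left_mono)
  moreover have "\<bar>(1 - nedges * p) * h y\<bar> \<le> (1 - nedges * p) * B"
    using p1 assms by (simp add: abs_mult mult_left_mono)
  ultimately have "\<bar>heat p h y\<bar> \<le> (1 - nedges * p) * B + p * (nedges * B)"
    unfolding heat_convex by linarith
  then show ?thesis by (simp add: algebra_simps)
qed

lemma heat_L1: "(\<Sum>y\<in>V. \<bar>heat p h y\<bar>) \<le> (\<Sum>y\<in>V. \<bar>h y\<bar>)"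
proof -
  have "(\<Sum>y\<in>V. \<bar>heat p h y\<bar>)
      \<le> (\<Sum>y\<in>V. (1 - nedges * p) * \<bar>h y\<bar> + p * (\<Sum>e\<in>edges. \<bar>avg e h y\<bar>))"
  proof (rule sum_mono)
    fix y
    have "\<bar>p * (\<Sum>e\<in>edges. avg e h y)\<bar> \<le> p * (\<Sum>e\<in>edges. \<bar>avg e h y\<bar>)"
      using p0 sum_abs[of "\<lambda>e. avg e h y" edges] by (simp add: abs_mult mult_left_mono)
    moreover have "\<bar>(1 - nedges * p) * h y\<bar> = (1 - nedges * p) * \<bar>h y\<bar>"
      using p1 by (simp add: abs_mult)
    ultimately show "\<bar>heat p h y\<bar>
        \<le> (1 - nedges * p) * \<bar>h y\<bar> + p * (\<Sum>e\<in>edges. \<bar>avg e h y\<bar>)"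
      unfolding heat_convex by linarith
  qed
  also have "\<dots> = (1 - nedges * p) * (\<Sum>y\<in>V. \<bar>h y\<bar>)
      + p * (\<Sum>e\<in>edges. \<Sum>y\<in>V. \<bar>avg e h y\<bar>)"
    unfolding sum.distrib sum_distrib_left[symmetric] by (subst sum.swap) simp
  also have "\<dots> \<le> (1 - nedges * p) * (\<Sum>y\<in>V. \<bar>h y\<bar>)
      + p * (\<Sum>e\<in>edges. \<Sum>y\<in>V. \<bar>h y\<bar>)"
    using p0 by (intro add_left_mono mult_left_mono sum_mono avg_L1) auto
  also have "\<dots> = (\<Sum>y\<in>V. \<bar>h y\<bar>)" by (simp add: nedges_def algebra_simps)
  finally show ?thesis .
qed

lemma heat_pow_sup:
  assumes "\<And>x. x \<in> V \<Longrightarrow> \<bar>h x\<bar> \<le> B" and "y \<in> V"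
  shows "\<bar>(heat p ^^ k) h y\<bar> \<le> B"
  using assms(2)
  by (induction k arbitrary: y) (auto simp: assms(1) intro!: heat_sup)

lemma heat_pow_L1: "(\<Sum>y\<in>V. \<bar>(heat p ^^ k) h y\<bar>) \<le> (\<Sum>y\<in>V. \<bar>h y\<bar>)"
  by (induction k) (use heat_L1 order.trans in \<open>fastforce+\<close>)

end

section \<open>Linearity and symmetries of the heat flow\<close>

lemma heat_add:
  "heat p (\<lambda>y. h y + g y) = (\<lambda>y. heat p h y + heat p g y)"
  by (rule ext) (simp add: heat_def dif_def algebra_simps sum.distrib sum_subtractf)

lemma heat_scale: "heat p (\<lambda>y. c * h y) = (\<lambda>y. c * heat p h y)"
  by (rule ext) (simp add: heat_def dif_def algebra_simps sum_distrib_left)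

lemma heat_pow_add:
  "(heat p ^^ k) (\<lambda>y. h y + g y) = (\<lambda>y. (heat p ^^ k) h y + (heat p ^^ k) g y)"
  by (induction k) (auto simp: heat_add)

lemma heat_pow_scale: "(heat p ^^ k) (\<lambda>y. c * h y) = (\<lambda>y. c * (heat p ^^ k) h y)"
  by (induction k) (auto simp: heat_scale)

lemma heat_pow_sum:
  assumes "finite S"
  shows "(heat p ^^ k) (\<lambda>y. \<Sum>e\<in>S. c e * g e y) = (\<lambda>y. \<Sum>e\<in>S. c e * (heat p ^^ k) (g e) y)"
  using assms
proof (induction S)
  case empty
  then show ?case using heat_pow_scale[of k p 0 "\<lambda>_. 0"] by simp
qed (simp add: heat_pow_add heat_pow_scale)

lemma heat_cong:
  assumes "\<And>x. x \<in> V \<Longrightarrow> h x = g x" and "y \<in> V"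
  shows "heat p h y = heat p g y"
  using assms tgt_V by (auto simp: heat_def dif_def intro!: sum.cong)

text \<open>A symmetry \<open>\<theta>\<close> moves the base point of an edge and keeps its
  direction, which permutes the terms of the sum in \<open>heat\<close>. It is applied to the steps
  \<open>sh i\<close> and to the translations \<open>tr x\<close>.\<close>

lemma heat_pow_comp:
  assumes bij: "bij_betw \<theta> V V" and comm: "\<And>i x. x \<in> V \<Longrightarrow> \<theta> (sh i x) = sh i (\<theta> x)"
    and "y \<in> V"
  shows "(heat p ^^ k) (\<lambda>x. h (\<theta> x)) y = (heat p ^^ k) h (\<theta> y)"
proof -
  have \<theta>V: "\<theta> x \<in> V" if "x \<in> V" for x using that bij bij_betwE by blast
  have inj: "\<theta> x = \<theta> z \<longleftrightarrow> x = z" if "x \<in> V" "z \<in> V" for x z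
    using that bij by (meson bij_betw_def inj_on_eq_iff)
  have step: "heat p (\<lambda>x. h (\<theta> x)) y = heat p h (\<theta> y)" if y: "y \<in> V" for h y
  proof -
    have bij2: "bij_betw (map_prod \<theta> id) edges edges"
      by (rule bij_betw_map_prod[OF bij]) simp
    have "(\<Sum>e\<in>edges. dif e (\<lambda>x. h (\<theta> x)) * dip e y)
        = (\<Sum>e\<in>edges. dif (map_prod \<theta> id e) h * dip (map_prod \<theta> id e) (\<theta> y))"
      by (rule sum.cong)
         (auto simp: dif_def dip_def tgt_def comm inj[OF y] sh_V simp flip: comm)
    also have "\<dots> = (\<Sum>e\<in>edges. dif e h * dip e (\<theta> y))"
      by (rule sum.reindex_bij_betw[OF bij2])
    finally show ?thesis by (simp add: heat_def)
  qed
  show ?thesis using \<open>y \<in> V\<close>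
  proof (induction k arbitrary: y)
    case (Suc k)
    have "(heat p ^^ Suc k) (\<lambda>x. h (\<theta> x)) y = heat p (\<lambda>x. (heat p ^^ k) h (\<theta> x)) y"
      using Suc by (auto intro!: heat_cong)
    then show ?case using step[OF Suc.prems] by simp
  qed simp
qed

text \<open>The step \<open>sh i\<close> is itself a symmetry, so each discrete derivative evolves
  by the heat flow and inherits its contraction bounds.\<close>

lemma dif_heat_pow:
  assumes "x \<in> V"
  shows "dif (x, i) ((heat p ^^ k) h) = (heat p ^^ k) (\<lambda>x. dif (x, i) h) x"
proof -
  have "(heat p ^^ k) (\<lambda>x. dif (x, i) h) x
      = (heat p ^^ k) (\<lambda>x. h (sh i x)) x + (-1) * (heat p ^^ k) h x"
    using heat_pow_add[of k p "\<lambda>x. h (sh i x)" "\<lambda>x. (-1) * h x"] heat_pow_scale[of k p "-1" h]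
    by (simp add: dif_def tgt_def)
  also have "(heat p ^^ k) (\<lambda>x. h (sh i x)) x = (heat p ^^ k) h (sh i x)"
    by (rule heat_pow_comp) (use sh_bij sh_commute assms in auto)
  finally show ?thesis by (simp add: dif_def tgt_def)
qed

section \<open>The Duhamel kernel and energy dissipation\<close>

definition ker :: "real \<Rightarrow> nat \<Rightarrow> 'i \<Rightarrow> 'v \<times> 'i \<Rightarrow> real" where
  "ker p k j e = (\<Sum>x\<in>V. (dif (x, j) ((heat p ^^ k) (dip e)))\<^sup>2)"

lemma ker_nonneg: "0 \<le> ker p k j e"
  by (simp add: ker_def sum_nonneg)

text \<open>The translation \<open>tr x\<close> carries the dipole at \<open>(orig, i)\<close> to
  the one at \<open>(x, i)\<close>, commutes with the flow and permutes the base points summed over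
  in \<open>ker\<close>. Hence the weight with which a source edge feeds all edges of direction
  \<open>j\<close> depends only on the direction of the source.\<close>

lemma ker_translate:
  assumes "x \<in> V"
  shows "ker p k j (x, i) = ker p k j (orig, i)"
proof -
  note x = assms
  have inj: "tr x y = tr x z \<longleftrightarrow> y = z" if "y \<in> V" "z \<in> V" for y z
    using that tr_bij[OF x] by (meson bij_betw_def inj_on_eq_iff)
  have dip: "dip (x, i) (tr x z) = dip (orig, i) z" if "z \<in> V" for z
    using inj[OF that orig_V] inj[OF that sh_V[OF orig_V]] tr_orig[OF x] tr_sh[OF x orig_V]
    by (simp add: dip_def tgt_def)
  have cong: "(heat p ^^ k) h z = (heat p ^^ k) g z"
    if "\<And>z. z \<in> V \<Longrightarrow> h z = g z" "z \<in> V" for h g z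
    using that(2) by (induction k arbitrary: z) (auto simp: that(1) intro!: heat_cong)
  have pow: "(heat p ^^ k) (dip (x, i)) (tr x z) = (heat p ^^ k) (dip (orig, i)) z" if z: "z \<in> V" for z
    using heat_pow_comp[OF tr_bij[OF x] tr_sh[OF x] z, of k p "dip (x, i)"]
      cong[OF dip z] by simp
  have "ker p k j (x, i) = (\<Sum>z\<in>V. (dif (tr x z, j) ((heat p ^^ k) (dip (x, i))))\<^sup>2)"
    unfolding ker_def
    by (rule sum.reindex_bij_betw[OF tr_bij[OF x], symmetric])
  also have "\<dots> = ker p k j (orig, i)"
    unfolding ker_def
    by (rule sum.cong) (auto simp: dif_def tgt_def pow sh_V simp flip: tr_sh[OF x])
  finally show ?thesis .
qed

lemma sum_dip:
  assumes "e \<in> edges"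
  shows "(\<Sum>z\<in>V. h z * dip e z) = dif e h"
  using assms finite_V tgt_V[OF assms]
  by (auto simp: dip_def dif_def right_diff_distrib sum_subtractf of_bool_def
      if_distrib[of "(*) _"] cong: if_cong)

lemma sum_dip_sq:
  assumes "e \<in> edges"
  shows "(\<Sum>z\<in>V. (dip e z)\<^sup>2) \<le> 2"
proof -
  have "(\<Sum>z\<in>V. (dip e z)\<^sup>2) = dif e (dip e)"
    using sum_dip[OF assms, of "dip e"] by (simp add: power2_eq_square)
  also have "\<dots> \<le> 2" by (simp add: dif_def dip_def)
  finally show ?thesis .
qed

text \<open>Expand the square of \<open>h z - p / 2 * L z\<close>. By summation by parts the cross
  term is exactly \<open>- p * D\<close>; Cauchy-Schwarz over the edges bounds the quadratic term by
  \<open>p\<^sup>2 / 2 * nedges * D\<close>. The factor \<open>1 - nedges * p / 2\<close> is thus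
  the price of discrete time.\<close>

lemma heat_energy:
  assumes "0 \<le> p"
  shows "p * (1 - nedges * p / 2) * (\<Sum>e\<in>edges. (dif e h)\<^sup>2)
     \<le> (\<Sum>z\<in>V. (h z)\<^sup>2) - (\<Sum>z\<in>V. (heat p h z)\<^sup>2)"
proof -
  define L where "L z = (\<Sum>e\<in>edges. dif e h * dip e z)" for z
  define D where "D = (\<Sum>e\<in>edges. (dif e h)\<^sup>2)"
  have "(\<Sum>z\<in>V. h z * L z) = (\<Sum>e\<in>edges. dif e h * (\<Sum>z\<in>V. h z * dip e z))"
    unfolding L_def sum_distrib_left by (subst sum.swap) (simp add: mult_ac)
  also have "\<dots> = D"
    unfolding D_def by (rule sum.cong) (auto simp: sum_dip power2_eq_square)
  finally have hL: "(\<Sum>z\<in>V. h z * L z) = D" .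
  have "(\<Sum>z\<in>V. (L z)\<^sup>2) \<le> (\<Sum>z\<in>V. nedges * (\<Sum>e\<in>edges. (dif e h * dip e z)\<^sup>2))"
    unfolding L_def nedges_def
    by (intro sum_mono order.trans[OF sum_squared_le_sum_of_squares]) (auto simp: finite_edges mult_ac)
  also have "\<dots> = nedges * (\<Sum>e\<in>edges. (dif e h)\<^sup>2 * (\<Sum>z\<in>V. (dip e z)\<^sup>2))"
    unfolding sum_distrib_left by (subst sum.swap) (simp add: power_mult_distrib)
  also have "\<dots> \<le> nedges * (\<Sum>e\<in>edges. (dif e h)\<^sup>2 * 2)"
    by (intro mult_left_mono sum_mono sum_dip_sq nedges_nonneg) auto
  finally have LL: "(\<Sum>z\<in>V. (L z)\<^sup>2) \<le> 2 * nedges * D"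
    by (simp add: D_def sum_distrib_left sum_distrib_right mult_ac)
  have "(\<Sum>z\<in>V. (heat p h z)\<^sup>2)
      = (\<Sum>z\<in>V. (h z)\<^sup>2 - p * (h z * L z) + p\<^sup>2 / 4 * (L z)\<^sup>2)"
    by (rule sum.cong) (auto simp: heat_def L_def[symmetric] power2_eq_square field_simps)
  also have "\<dots> = (\<Sum>z\<in>V. (h z)\<^sup>2) - p * D + p\<^sup>2 / 4 * (\<Sum>z\<in>V. (L z)\<^sup>2)"
    unfolding sum.distrib sum_subtractf sum_distrib_left[symmetric] hL ..
  also have "\<dots> \<le> (\<Sum>z\<in>V. (h z)\<^sup>2) - p * D + p\<^sup>2 / 4 * (2 * nedges * D)"
    using LL by (intro add_left_mono mult_left_mono) auto
  finally show ?thesis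
    unfolding D_def[symmetric] by (simp add: power2_eq_square[of p] field_simps)
qed

text \<open>Summing the energy inequality along the flow started from a dipole, the squared L2 norms
  telescope, and the first of them is at most \<open>2\<close>. The bound is uniform in
  \<open>n\<close>; with the prefactor \<open>1 / 4\<close> of the Duhamel formula it tends to
  \<open>1 / 2\<close> as \<open>p\<close> tends to 0.\<close>

lemma sum_ker_le:
  assumes "0 \<le> p" "nedges * p < 2" and e: "e \<in> edges"
  shows "p * (\<Sum>j\<in>UNIV. \<Sum>k<n. ker p k j e) \<le> 2 / (1 - nedges * p / 2)"
proof -
  define c where "c = 1 - nedges * p / 2"
  have c: "c > 0" using assms by (simp add: c_def)
  define S where "S k = (\<Sum>z\<in>V. ((heat p ^^ k) (dip e) z)\<^sup>2)" for k
  have D: "(\<Sum>j\<in>UNIV. ker p k j e) = (\<Sum>a\<in>edges. (dif a ((heat p ^^ k) (dip e)))\<^sup>2)" for k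
    unfolding ker_def by (subst sum.swap) (simp add: sum.cartesian_product)
  have "c * p * (\<Sum>j\<in>UNIV. \<Sum>k<n. ker p k j e) = (\<Sum>k<n. c * p * (\<Sum>j\<in>UNIV. ker p k j e))"
    by (subst sum.swap) (simp add: sum_distrib_left)
  also have "\<dots> \<le> (\<Sum>k<n. S k - S (Suc k))"
    by (rule sum_mono)
       (use heat_energy[OF assms(1), of "(heat p ^^ _) (dip e)"] in
         \<open>auto simp: D S_def c_def mult_ac\<close>)
  also have "\<dots> = S 0 - S n" by (rule sum_lessThan_telescope')
  also have "\<dots> \<le> 2"
    using sum_dip_sq[OF e] by (simp add: S_def) (smt (verit) sum_nonneg zero_le_power2)
  finally show ?thesis
    unfolding c_def[symmetric] pos_le_divide_eq[OF c] by (simp add: mult_ac)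
qed

section \<open>The Markov chain on pairs of functions\<close>

definition chain_step ::
    "real \<Rightarrow> (('v \<Rightarrow> real) \<Rightarrow> ('v \<Rightarrow> real) \<Rightarrow> real) \<Rightarrow> ('v \<Rightarrow> real) \<Rightarrow> ('v \<Rightarrow> real) \<Rightarrow> real" where
  "chain_step p \<Phi> u v = (1 - nedges * p) * \<Phi> u v + p * (\<Sum>e\<in>edges. \<Phi> (avg e u) (avg e v))"

text \<open>\<open>chain p k \<Phi> u v\<close> is the expectation of \<open>\<Phi>\<close> after \<open>k\<close> steps of the Markov chain which
  averages both functions along each edge with probability \<open>p\<close> and rests otherwise.\<close>

primrec chain ::
    "real \<Rightarrow> nat \<Rightarrow> (('v \<Rightarrow> real) \<Rightarrow> ('v \<Rightarrow> real) \<Rightarrow> real) \<Rightarrow> ('v \<Rightarrow> real) \<Rightarrow> ('v \<Rightarrow> real) \<Rightarrow> real" where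
  "chain p 0 \<Phi> = \<Phi>"
| "chain p (Suc k) \<Phi> = chain p k (chain_step p \<Phi>)"

lemma chain_step_add:
  "chain_step p (\<lambda>u v. \<Phi> u v + \<Psi> u v) = (\<lambda>u v. chain_step p \<Phi> u v + chain_step p \<Psi> u v)"
  by (intro ext) (simp add: chain_step_def sum.distrib algebra_simps)

lemma chain_step_scale:
  "chain_step p (\<lambda>u v. c * \<Phi> u v) = (\<lambda>u v. c * chain_step p \<Phi> u v)"
  by (intro ext) (simp add: chain_step_def sum_distrib_left algebra_simps)

lemma chain_add:
  "chain p k (\<lambda>u v. \<Phi> u v + \<Psi> u v) = (\<lambda>u v. chain p k \<Phi> u v + chain p k \<Psi> u v)"
  by (induction k arbitrary: \<Phi> \<Psi>) (simp_all add: chain_step_add)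

lemma chain_scale: "chain p k (\<lambda>u v. c * \<Phi> u v) = (\<lambda>u v. c * chain p k \<Phi> u v)"
  by (induction k arbitrary: \<Phi>) (simp_all add: chain_step_scale)

lemma chain_sum:
  assumes "finite S"
  shows "chain p k (\<lambda>u v. \<Sum>e\<in>S. c e * \<Phi> e u v) = (\<lambda>u v. \<Sum>e\<in>S. c e * chain p k (\<Phi> e) u v)"
  using assms
proof (induction S)
  case empty
  then show ?case using chain_scale[of p k 0 "\<lambda>_ _. 0"] by simp
qed (simp add: chain_add chain_scale)

text \<open>Averaging preserves both maximum bounds, so a bound on \<open>\<Phi>\<close> over all
  functions obeying them is inherited by \<open>chain_step p \<Phi>\<close>. This is why
  \<open>bound\<close> quantifies over all such functions.\<close>

lemma chain_bound:
  assumes p: "0 \<le> p" "nedges * p \<le> 1"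
    and bound: "\<And>u v. (\<And>x. x \<in> V \<Longrightarrow> \<bar>u x\<bar> \<le> A) \<Longrightarrow> (\<And>x. x \<in> V \<Longrightarrow> \<bar>v x\<bar> \<le> B) \<Longrightarrow> \<bar>\<Phi> u v\<bar> \<le> K"
    and u: "\<And>x. x \<in> V \<Longrightarrow> \<bar>u x\<bar> \<le> A" and v: "\<And>x. x \<in> V \<Longrightarrow> \<bar>v x\<bar> \<le> B"
  shows "\<bar>chain p k \<Phi> u v\<bar> \<le> K"
  using bound
proof (induction k arbitrary: \<Phi>)
  case 0
  then show ?case using u v by simp
next
  case (Suc k)
  have "\<bar>chain_step p \<Phi> u v\<bar> \<le> K"
    if uv: "\<And>x. x \<in> V \<Longrightarrow> \<bar>u x\<bar> \<le> A" "\<And>x. x \<in> V \<Longrightarrow> \<bar>v x\<bar> \<le> B" for u v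
  proof -
    have "\<bar>\<Phi> (avg e u) (avg e v)\<bar> \<le> K" if "e \<in> edges" for e
      by (rule Suc.prems) (use avg_sup[OF that uv(1)] avg_sup[OF that uv(2)] in auto)
    then have "\<bar>\<Sum>e\<in>edges. \<Phi> (avg e u) (avg e v)\<bar> \<le> (\<Sum>e\<in>edges. K)"
      by (intro order.trans[OF sum_abs] sum_mono) auto
    then have "\<bar>p * (\<Sum>e\<in>edges. \<Phi> (avg e u) (avg e v))\<bar> \<le> p * (nedges * K)"
      using p by (simp add: abs_mult mult_left_mono nedges_def)
    moreover have "\<bar>(1 - nedges * p) * \<Phi> u v\<bar> \<le> (1 - nedges * p) * K"
      using p Suc.prems[OF uv] by (simp add: abs_mult mult_left_mono)
    ultimately have "\<bar>chain_step p \<Phi> u v\<bar> \<le> (1 - nedges * p) * K + p * (nedges * K)"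
      unfolding chain_step_def by linarith
    then show ?thesis by (simp add: algebra_simps)
  qed
  then show ?case using Suc.IH by simp
qed

section \<open>Duhamel expansion of the correlations\<close>

definition dheat :: "real \<Rightarrow> nat \<Rightarrow> 'v \<times> 'i \<Rightarrow> ('v \<Rightarrow> real) \<Rightarrow> real" where
  "dheat p j a h = dif a ((heat p ^^ j) h)"

lemma dheat_avg: "dheat p j a (avg e h) = dheat p j a h - dif e h / 2 * dheat p j a (dip e)"
  using heat_pow_add[of j p h "\<lambda>y. (- (dif e h / 2)) * dip e y"]
    heat_pow_scale[of j p "- (dif e h / 2)" "dip e"]
  by (simp add: dheat_def avg_def dif_def[of a] algebra_simps)

lemma dheat_heat:
  "dheat p j a (heat p h) = dheat p j a h - p / 2 * (\<Sum>e\<in>edges. dif e h * dheat p j a (dip e))"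
proof -
  have "(heat p ^^ j) (heat p h) = (\<lambda>y. (heat p ^^ j) h y
      + (- (p / 2)) * (\<Sum>e\<in>edges. dif e h * (heat p ^^ j) (dip e) y))"
    using heat_pow_add[of j p h "\<lambda>y. (- (p / 2)) * (\<Sum>e\<in>edges. dif e h * dip e y)"]
      heat_pow_scale[of j p "- (p / 2)" "\<lambda>y. \<Sum>e\<in>edges. dif e h * dip e y"]
      heat_pow_sum[OF finite_edges, of j p "\<lambda>e. dif e h" dip]
    by (simp add: heat_def)
  then show ?thesis
    by (simp add: dheat_def dif_def[of a] algebra_simps sum_subtractf)
qed

text \<open>The covariance created in one step is, up to second order in \<open>p\<close>, a sum over the edges
  with nonnegative coefficients.\<close>

lemma chain_step_dheat:
  "chain_step p (\<lambda>u v. dheat p j a u * dheat p j a v) =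
    (\<lambda>u v. dheat p (Suc j) a u * dheat p (Suc j) a v
      + ((\<Sum>e\<in>edges. (p / 4 * (dheat p j a (dip e))\<^sup>2) * (dif e u * dif e v))
      + (- (p\<^sup>2 / 4)) * ((\<Sum>e\<in>edges. dif e u * dheat p j a (dip e))
                        * (\<Sum>e\<in>edges. dif e v * dheat p j a (dip e)))))"
proof (intro ext)
  fix u v
  define r where "r = dheat p j a"
  define X where "X h = (\<Sum>e\<in>edges. dif e h * r (dip e))" for h
  have "(\<Sum>e\<in>edges. r (avg e u) * r (avg e v))
      = (\<Sum>e\<in>edges. r u * r v - r v / 2 * (dif e u * r (dip e)) - r u / 2 * (dif e v * r (dip e))
            + 1 / 4 * ((r (dip e))\<^sup>2 * (dif e u * dif e v)))"
    unfolding r_def dheat_avg by (rule sum.cong) (auto simp: field_simps power2_eq_square)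
  also have "\<dots> = nedges * (r u * r v) - r v / 2 * X u - r u / 2 * X v
      + 1 / 4 * (\<Sum>e\<in>edges. (r (dip e))\<^sup>2 * (dif e u * dif e v))"
    unfolding X_def nedges_def by (simp add: sum.distrib sum_subtractf sum_distrib_left)
  finally have "chain_step p (\<lambda>u v. r u * r v) u v = (1 - nedges * p) * (r u * r v)
      + p * (nedges * (r u * r v) - r v / 2 * X u - r u / 2 * X v
        + 1 / 4 * (\<Sum>e\<in>edges. (r (dip e))\<^sup>2 * (dif e u * dif e v)))"
    unfolding chain_step_def by simp
  \<comment> \<open>The terms of first order in \<open>p\<close> are completed to a product of two
    Euler steps; the added \<open>p\<^sup>2 / 4 * (X u * X v)\<close> is subtracted again as the
    second-order error.\<close>
  also have "\<dots> = (r u - p / 2 * X u) * (r v - p / 2 * X v)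
      + (p / 4 * (\<Sum>e\<in>edges. (r (dip e))\<^sup>2 * (dif e u * dif e v))
      + (- (p\<^sup>2 / 4)) * (X u * X v))"
    by (simp add: field_simps power2_eq_square)
  also have "p / 4 * (\<Sum>e\<in>edges. (r (dip e))\<^sup>2 * (dif e u * dif e v))
      = (\<Sum>e\<in>edges. (p / 4 * (r (dip e))\<^sup>2) * (dif e u * dif e v))"
    by (simp add: sum_distrib_left mult.assoc)
  also have "r u - p / 2 * X u = dheat p (Suc j) a u"
    unfolding r_def X_def dheat_heat[symmetric] by (simp add: dheat_def funpow_swap1)
  also have "r v - p / 2 * X v = dheat p (Suc j) a v"
    unfolding r_def X_def dheat_heat[symmetric] by (simp add: dheat_def funpow_swap1)
  finally show "chain_step p (\<lambda>u v. dheat p j a u * dheat p j a v) u v =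
      dheat p (Suc j) a u * dheat p (Suc j) a v
      + ((\<Sum>e\<in>edges. (p / 4 * (dheat p j a (dip e))\<^sup>2) * (dif e u * dif e v))
      + (- (p\<^sup>2 / 4)) * ((\<Sum>e\<in>edges. dif e u * dheat p j a (dip e))
                        * (\<Sum>e\<in>edges. dif e v * dheat p j a (dip e))))"
    unfolding r_def X_def .
qed

definition corr :: "real \<Rightarrow> nat \<Rightarrow> ('v \<Rightarrow> real) \<Rightarrow> ('v \<Rightarrow> real) \<Rightarrow> 'v \<times> 'i \<Rightarrow> real" where
  "corr p k u v e = chain p k (\<lambda>u v. dif e u * dif e v) u v"

context
  fixes p A B :: real and u v :: "'v \<Rightarrow> real"
  assumes p: "0 \<le> p" "nedges * p \<le> 1"
    and u: "\<And>x. x \<in> V \<Longrightarrow> \<bar>u x\<bar> \<le> A" and v: "\<And>x. x \<in> V \<Longrightarrow> \<bar>v x\<bar> \<le> B"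
begin

text \<open>Each difference of \<open>h\<close> is at most \<open>2 * C\<close>, and a dipole stays
  bounded by 1 under the flow. This crude bound suffices because it enters with a factor
  \<open>p\<^sup>2\<close> and only \<open>n\<close> times, with \<open>p\<close> of order
  \<open>1 / n\<close> in the application.\<close>

lemma abs_sum_dif_dheat_le:
  assumes "\<And>x. x \<in> V \<Longrightarrow> \<bar>h x\<bar> \<le> C" "a \<in> edges"
  shows "\<bar>\<Sum>e\<in>edges. dif e h * dheat p j a (dip e)\<bar> \<le> 4 * nedges * C"
proof -
  have "\<bar>\<Sum>e\<in>edges. dif e h * dheat p j a (dip e)\<bar> \<le> (\<Sum>e\<in>edges. (2 * C) * (2 * 1))"
  proof (intro order.trans[OF sum_abs] sum_mono)
    fix e assume e: "e \<in> edges"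
    have "\<bar>dheat p j a (dip e)\<bar> \<le> 2 * 1"
      unfolding dheat_def using heat_pow_sup[OF p] abs_dip_le assms(2) by (intro dif_sup) auto
    then show "\<bar>dif e h * dheat p j a (dip e)\<bar> \<le> (2 * C) * (2 * 1)"
      unfolding abs_mult using dif_sup[OF assms(1) e]
      by (intro mult_mono order.trans[OF abs_ge_zero dif_sup[OF assms(1) e]]) auto
  qed
  then show ?thesis by (simp add: nedges_def)
qed

text \<open>Interpolation between heat flow and chain: at stage \<open>k\<close> the chain runs for
  \<open>k\<close> steps and the heat flow for the remaining \<open>n - k\<close>. Passing to stage
  \<open>Suc k\<close> trades one heat step for a chain step; by \<open>chain_step_dheat\<close>
  this creates covariance on the edges, which the remaining \<open>n - Suc k\<close> heat steps
  carry to \<open>a\<close>.\<close>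

lemma duhamel:
  assumes a: "a \<in> edges" and "k \<le> n"
  shows "\<bar>chain p k (\<lambda>u v. dheat p (n - k) a u * dheat p (n - k) a v) u v\<bar>
    \<le> \<bar>dheat p n a u * dheat p n a v\<bar>
      + (\<Sum>l<k. (\<Sum>e\<in>edges. p / 4 * (dheat p (n - Suc l) a (dip e))\<^sup>2 * \<bar>corr p l u v e\<bar>)
          + 4 * p\<^sup>2 * nedges\<^sup>2 * A * B)"
  using \<open>k \<le> n\<close>
proof (induction k)
  case 0
  then show ?case by simp
next
  case (Suc k)
  define j where "j = n - Suc k"
  define Y where "Y u v = (\<Sum>e\<in>edges. dif e u * dheat p j a (dip e))
                        * (\<Sum>e\<in>edges. dif e v * dheat p j a (dip e))" for u v
  have j: "n - k = Suc j" using Suc.prems by (simp add: j_def)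
  have "chain p (Suc k) (\<lambda>u v. dheat p j a u * dheat p j a v) u v
      = chain p k (\<lambda>u v. dheat p (Suc j) a u * dheat p (Suc j) a v) u v
      + ((\<Sum>e\<in>edges. (p / 4 * (dheat p j a (dip e))\<^sup>2) * corr p k u v e)
        + (- (p\<^sup>2 / 4)) * chain p k Y u v)"
    unfolding chain.simps chain_step_dheat chain_add chain_scale chain_sum[OF finite_edges] corr_def
      Y_def ..
  moreover have "\<bar>\<Sum>e\<in>edges. (p / 4 * (dheat p j a (dip e))\<^sup>2) * corr p k u v e\<bar>
      \<le> (\<Sum>e\<in>edges. (p / 4 * (dheat p j a (dip e))\<^sup>2) * \<bar>corr p k u v e\<bar>)"
    by (rule order.trans[OF sum_abs]) (simp add: abs_mult p)
  moreover have "\<bar>chain p k Y u v\<bar> \<le> (4 * nedges * A) * (4 * nedges * B)"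
  proof (rule chain_bound[OF p _ u v])
    fix u v :: "'v \<Rightarrow> real"
    assume uv: "\<And>x. x \<in> V \<Longrightarrow> \<bar>u x\<bar> \<le> A" "\<And>x. x \<in> V \<Longrightarrow> \<bar>v x\<bar> \<le> B"
    show "\<bar>Y u v\<bar> \<le> (4 * nedges * A) * (4 * nedges * B)"
      unfolding Y_def abs_mult
      by (intro mult_mono abs_sum_dif_dheat_le[OF uv(1) a] abs_sum_dif_dheat_le[OF uv(2) a] abs_ge_zero
          order.trans[OF abs_ge_zero abs_sum_dif_dheat_le[OF uv(1) a]])
  qed
  then have "\<bar>(- (p\<^sup>2 / 4)) * chain p k Y u v\<bar> \<le> p\<^sup>2 / 4 * ((4 * nedges * A) * (4 * nedges * B))"
    unfolding abs_mult by (intro mult_mono) auto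
  then have "\<bar>(- (p\<^sup>2 / 4)) * chain p k Y u v\<bar> \<le> 4 * p\<^sup>2 * nedges\<^sup>2 * A * B"
    by (simp add: power2_eq_square mult_ac)
  ultimately have "\<bar>chain p (Suc k) (\<lambda>u v. dheat p j a u * dheat p j a v) u v\<bar>
      \<le> \<bar>chain p k (\<lambda>u v. dheat p (Suc j) a u * dheat p (Suc j) a v) u v\<bar>
        + ((\<Sum>e\<in>edges. (p / 4 * (dheat p j a (dip e))\<^sup>2) * \<bar>corr p k u v e\<bar>)
        + 4 * p\<^sup>2 * nedges\<^sup>2 * A * B)"
    by linarith
  then show ?case using Suc.IH Suc.prems unfolding j by (simp add: j_def del: chain.simps)
qed

lemma duhamel_corr:
  assumes "a \<in> edges"
  shows "\<bar>corr p n u v a\<bar> \<le> \<bar>dheat p n a u * dheat p n a v\<bar>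
      + (\<Sum>l<n. (\<Sum>e\<in>edges. p / 4 * (dheat p (n - Suc l) a (dip e))\<^sup>2 * \<bar>corr p l u v e\<bar>)
          + 4 * p\<^sup>2 * nedges\<^sup>2 * A * B)"
  using duhamel[OF assms order.refl] by (simp add: corr_def dheat_def)

text \<open>Derivatives evolve by the heat flow: the factor from \<open>u\<close> keeps its maximum
  bound \<open>C\<close>, and the factor from \<open>v\<close> does not grow in L1.\<close>

lemma sum_dheat_le:
  assumes M: "\<And>e. e \<in> edges \<Longrightarrow> \<bar>dif e u\<bar> \<le> C"
  shows "(\<Sum>x\<in>V. \<bar>dheat p k (x, j) u * dheat p k (x, j) v\<bar>) \<le> C * (\<Sum>x\<in>V. \<bar>dif (x, j) v\<bar>)"
proof -
  have "(\<Sum>x\<in>V. \<bar>dheat p k (x, j) u * dheat p k (x, j) v\<bar>)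
      \<le> (\<Sum>x\<in>V. C * \<bar>(heat p ^^ k) (\<lambda>x. dif (x, j) v) x\<bar>)"
    unfolding dheat_def abs_mult
    by (intro sum_mono mult_mono)
      (auto simp: dif_heat_pow intro!: heat_pow_sup[OF p] M order.trans[OF abs_ge_zero M[of "(orig, j)"]] orig_V)
  also have "\<dots> \<le> C * (\<Sum>x\<in>V. \<bar>dif (x, j) v\<bar>)"
    unfolding sum_distrib_left[symmetric]
    by (intro mult_left_mono heat_pow_L1[OF p] order.trans[OF abs_ge_zero M[of "(orig, j)"]])
      (simp add: orig_V)
  finally show ?thesis .
qed

text \<open>The Duhamel bound is summed over the positions of the target edge, the correlations of
  each source direction are replaced by their maximum over time, and then target directions are
  summed. The total of these maxima is at most the source and error terms plus itself divided by
  \<open>2 - nedges * p\<close>; solving for it gives the last factor, which tends to 2 as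
  \<open>p\<close> tends to 0.\<close>

lemma sum_corr_le:
  assumes M: "\<And>e. e \<in> edges \<Longrightarrow> \<bar>dif e u\<bar> \<le> C" and p1: "nedges * p < 1"
  shows "(\<Sum>e\<in>edges. \<bar>corr p n u v e\<bar>)
    \<le> (C * (\<Sum>e\<in>edges. \<bar>dif e v\<bar>) + 4 * real n * p\<^sup>2 * nedges ^ 3 * A * B)
        * ((2 - nedges * p) / (1 - nedges * p))"
proof -
  define H where "H j k = (\<Sum>x\<in>V. \<bar>corr p k u v (x, j)\<bar>)" for j k
  \<comment> \<open>One maximum per direction, over finitely many times and after summing over
    positions: these are the finite quantities to be absorbed.\<close>
  define S where "S j = Max (H j ` {..n})" for j
  define K where "K j i = (\<Sum>k<n. ker p k j (orig, i))" for j i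
  define a where "a j = C * (\<Sum>x\<in>V. \<bar>dif (x, j) v\<bar>)" for j
  define err where "err = 4 * p\<^sup>2 * nedges\<^sup>2 * A * B"
  have A0: "0 \<le> A" and B0: "0 \<le> B"
    using order.trans[OF abs_ge_zero u[OF orig_V]] order.trans[OF abs_ge_zero v[OF orig_V]] by auto
  have err0: "0 \<le> err" using A0 B0 by (simp add: err_def)
  have H_le_S: "H j k \<le> S j" if "k \<le> n" for j k
    unfolding S_def using that by (intro Max_ge) auto
  have H0: "0 \<le> H j k" for j k by (simp add: H_def sum_nonneg)
  have S0: "0 \<le> S j" for j using H0 H_le_S order.trans by blast
  have H_le: "H j k \<le> a j + card V * (n * err) + (\<Sum>i\<in>UNIV. p / 4 * K j i * S i)" if k: "k \<le> n" for j k
  proof -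
    have "H j k \<le> (\<Sum>x\<in>V. \<bar>dheat p k (x, j) u * dheat p k (x, j) v\<bar>
        + (\<Sum>l<k. (\<Sum>e\<in>edges. p / 4 * (dheat p (k - Suc l) (x, j) (dip e))\<^sup>2 * \<bar>corr p l u v e\<bar>)
          + err))"
      unfolding H_def err_def by (intro sum_mono duhamel_corr) auto
    also have "\<dots> = (\<Sum>x\<in>V. \<bar>dheat p k (x, j) u * dheat p k (x, j) v\<bar>) + card V * (k * err)
        + (\<Sum>x\<in>V. \<Sum>l<k. \<Sum>e\<in>edges. p / 4 * (dheat p (k - Suc l) (x, j) (dip e))\<^sup>2 * \<bar>corr p l u v e\<bar>)"
      by (simp add: sum.distrib algebra_simps)
    also have "(\<Sum>x\<in>V. \<Sum>l<k. \<Sum>e\<in>edges. p / 4 * (dheat p (k - Suc l) (x, j) (dip e))\<^sup>2 * \<bar>corr p l u v e\<bar>)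
        = (\<Sum>l<k. \<Sum>e\<in>edges. \<Sum>x\<in>V. p / 4 * (dheat p (k - Suc l) (x, j) (dip e))\<^sup>2 * \<bar>corr p l u v e\<bar>)"
      by (subst sum.swap, intro sum.cong refl, subst sum.swap, rule refl)
    also have "\<dots> = (\<Sum>l<k. \<Sum>e\<in>edges. p / 4 * ker p (k - Suc l) j e * \<bar>corr p l u v e\<bar>)"
      by (simp add: ker_def dheat_def sum_distrib_left sum_distrib_right)
    \<comment> \<open>Translation invariance frees the kernel from the position of the source, so
      the correlations can be summed over positions into \<open>H i l\<close>.\<close>
    also have "\<dots> = (\<Sum>l<k. \<Sum>i\<in>UNIV. \<Sum>x\<in>V. p / 4 * ker p (k - Suc l) j (orig, i) * \<bar>corr p l u v (x, i)\<bar>)"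
    proof (rule sum.cong[OF refl])
      fix l
      show "(\<Sum>e\<in>edges. p / 4 * ker p (k - Suc l) j e * \<bar>corr p l u v e\<bar>)
          = (\<Sum>i\<in>UNIV. \<Sum>x\<in>V. p / 4 * ker p (k - Suc l) j (orig, i) * \<bar>corr p l u v (x, i)\<bar>)"
        by (subst sum.swap, subst sum.cartesian_product, rule sum.cong) (auto simp: ker_translate)
    qed
    also have "\<dots> = (\<Sum>i\<in>UNIV. \<Sum>l<k. p / 4 * ker p (k - Suc l) j (orig, i) * H i l)"
      by (subst sum.swap) (simp add: H_def sum_distrib_left)
    also have "\<dots> \<le> (\<Sum>i\<in>UNIV. p / 4 * K j i * S i)"
    proof (rule sum_mono)
      fix i
      have "(\<Sum>l<k. p / 4 * ker p (k - Suc l) j (orig, i) * H i l)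
          \<le> (\<Sum>l<k. p / 4 * ker p (k - Suc l) j (orig, i) * S i)"
        using k by (intro sum_mono mult_left_mono H_le_S) (auto simp: ker_nonneg p)
      also have "\<dots> = p / 4 * (\<Sum>l<k. ker p (k - Suc l) j (orig, i)) * S i"
        by (simp add: sum_distrib_left sum_distrib_right)
      \<comment> \<open>The sum now runs over the age of a source instead of its time of creation,
        so it can be extended from \<open>k\<close> to \<open>n\<close>.\<close>
      also have "(\<Sum>l<k. ker p (k - Suc l) j (orig, i)) = (\<Sum>l<k. ker p l j (orig, i))"
        by (rule sum.nat_diff_reindex)
      also have "p / 4 * (\<Sum>l<k. ker p l j (orig, i)) * S i \<le> p / 4 * K j i * S i"
        unfolding K_def using k
        by (intro mult_right_mono mult_left_mono sum_mono2) (auto simp: ker_nonneg p S0)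
      finally show "(\<Sum>l<k. p / 4 * ker p (k - Suc l) j (orig, i) * H i l) \<le> p / 4 * K j i * S i" .
    qed
    also have "(\<Sum>x\<in>V. \<bar>dheat p k (x, j) u * dheat p k (x, j) v\<bar>) \<le> a j"
      unfolding a_def by (rule sum_dheat_le[OF M])
    also have "card V * (k * err) \<le> card V * (n * err)"
      using k err0 by (intro mult_left_mono mult_right_mono) auto
    finally show ?thesis by simp
  qed
  have "S j \<le> a j + card V * (n * err) + (\<Sum>i\<in>UNIV. p / 4 * K j i * S i)" for j
    unfolding S_def by (subst Max_le_iff) (use H_le in \<open>auto simp: S_def\<close>)
  then have "(\<Sum>j\<in>UNIV. S j) \<le> (\<Sum>j\<in>UNIV. a j + card V * (n * err) + (\<Sum>i\<in>UNIV. p / 4 * K j i * S i))"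
    by (rule sum_mono)
  \<comment> \<open>The order matters: for a fixed source direction \<open>i\<close> it is the sum
    over target directions \<open>j\<close> that \<open>sum_ker_le\<close> controls.\<close>
  also have "\<dots> = (\<Sum>j\<in>UNIV. a j) + nedges * (n * err) + (\<Sum>i\<in>UNIV. (p * (\<Sum>j\<in>UNIV. K j i)) * (S i / 4))"
    unfolding sum.distrib
    by (subst sum.swap[of _ UNIV])
      (simp add: nedges_def card_cartesian_product sum_distrib_left sum_distrib_right mult_ac)
  also have "(\<Sum>i\<in>UNIV. (p * (\<Sum>j\<in>UNIV. K j i)) * (S i / 4))
      \<le> (\<Sum>i\<in>UNIV. 2 / (1 - nedges * p / 2) * (S i / 4))"
    unfolding K_def using p1 p S0 by (intro sum_mono mult_right_mono sum_ker_le) (auto simp: orig_V)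
  also have "\<dots> = (\<Sum>i\<in>UNIV. S i) / (2 - nedges * p)"
    using p1 by (simp add: sum_divide_distrib field_simps)
  also have "nedges * (n * err) = 4 * real n * p\<^sup>2 * nedges ^ 3 * A * B"
    by (simp add: err_def power2_eq_square power3_eq_cube)
  also have "(\<Sum>j\<in>UNIV. a j) = C * (\<Sum>e\<in>edges. \<bar>dif e v\<bar>)"
    unfolding a_def sum_distrib_left[symmetric]
    by (subst sum.swap) (simp add: sum.cartesian_product)
  \<comment> \<open>The coefficient is \<open>1 - 1 / (2 - nedges * p)\<close>, positive by
    \<open>p1\<close>.\<close>
  finally have "(\<Sum>j\<in>UNIV. S j) * ((1 - nedges * p) / (2 - nedges * p))
      \<le> C * (\<Sum>e\<in>edges. \<bar>dif e v\<bar>) + 4 * real n * p\<^sup>2 * nedges ^ 3 * A * B"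
    using p1 by (simp add: field_simps)
  then have "(\<Sum>j\<in>UNIV. S j) \<le> (C * (\<Sum>e\<in>edges. \<bar>dif e v\<bar>) + 4 * real n * p\<^sup>2 * nedges ^ 3 * A * B)
        / ((1 - nedges * p) / (2 - nedges * p))"
    using p1 by (subst pos_le_divide_eq) auto
  moreover have "(\<Sum>e\<in>edges. \<bar>corr p n u v e\<bar>) = (\<Sum>j\<in>UNIV. H j n)"
    unfolding H_def by (subst sum.swap) (simp add: sum.cartesian_product)
  moreover have "(\<Sum>j\<in>UNIV. H j n) \<le> (\<Sum>j\<in>UNIV. S j)"
    by (intro sum_mono H_le_S) simp
  ultimately show ?thesis by simp
qed

end

end

section \<open>Independent Poisson counts on a grid of intervals\<close>

text \<open>A product event over pairs factors over rows by \<open>outer\<close> and then inside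
  each row by \<open>inner\<close>. Product events suffice, since the subsets of the naturals form
  an intersection-stable generator.\<close>

lemma (in prob_space) indep_vars_pairs:
  fixes X :: "'i \<Rightarrow> 'j \<Rightarrow> 'a \<Rightarrow> nat"
  assumes fin: "finite I" "finite J" and ne: "I \<noteq> {}" "J \<noteq> {}"
    and inner: "\<And>i. i \<in> I \<Longrightarrow> indep_vars (\<lambda>_. count_space UNIV) (X i) J"
    and outer: "\<And>A. prob (\<Inter>i\<in>I. {\<omega>\<in>space M. \<forall>j\<in>J. X i j \<omega> \<in> A i j})
      = (\<Prod>i\<in>I. prob {\<omega>\<in>space M. \<forall>j\<in>J. X i j \<omega> \<in> A i j})"
  shows "indep_vars (\<lambda>_. count_space UNIV) (\<lambda>(i, j). X i j) (I \<times> J)"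
proof (subst indep_vars_finite[where E = "\<lambda>_. UNIV"])
  show "I \<times> J \<noteq> {}" "finite (I \<times> J)" using fin ne by auto
  have rv: "X i j \<in> measurable M (count_space UNIV)" if "i \<in> I" "j \<in> J" for i j
    using inner[OF that(1)] that(2) by (auto simp: indep_vars_def)
  show "random_variable (count_space UNIV) (case a of (i, j) \<Rightarrow> X i j)" if "a \<in> I \<times> J" for a
    using that rv by auto
  show "\<forall>A\<in>I \<times> J \<rightarrow> UNIV. prob (\<Inter>a\<in>I \<times> J. (case a of (i, j) \<Rightarrow> X i j) -` A a \<inter> space M)
      = (\<Prod>a\<in>I \<times> J. prob ((case a of (i, j) \<Rightarrow> X i j) -` A a \<inter> space M))"
  proof
    fix A :: "'i \<times> 'j \<Rightarrow> nat set"
    have "(\<Inter>a\<in>I \<times> J. (case a of (i, j) \<Rightarrow> X i j) -` A a \<inter> space M)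
        = (\<Inter>i\<in>I. {\<omega>\<in>space M. \<forall>j\<in>J. X i j \<omega> \<in> A (i, j)})"
      using ne by auto
    moreover have "prob {\<omega>\<in>space M. \<forall>j\<in>J. X i j \<omega> \<in> A (i, j)}
        = (\<Prod>j\<in>J. prob (X i j -` A (i, j) \<inter> space M))" if "i \<in> I" for i
    proof -
      have "{\<omega>\<in>space M. \<forall>j\<in>J. X i j \<omega> \<in> A (i, j)} = (\<Inter>j\<in>J. X i j -` A (i, j) \<inter> space M)"
        using ne by auto
      then show ?thesis using indep_varsD_finite[OF inner[OF that] ne(2) fin(2)] by simp
    qed
    ultimately show "prob (\<Inter>a\<in>I \<times> J. (case a of (i, j) \<Rightarrow> X i j) -` A a \<inter> space M)
      = (\<Prod>a\<in>I \<times> J. prob ((case a of (i, j) \<Rightarrow> X i j) -` A a \<inter> space M))"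
      by (simp add: outer prod.cartesian_product case_prod_beta)
  qed
qed (auto simp: Int_stable_def intro!: sigma_sets_eqI)

locale poisson_grid = prob_space M for M :: "'w measure" +
  fixes E :: "'e set" and X :: "'e \<Rightarrow> nat \<Rightarrow> 'w \<Rightarrow> nat" and n :: nat and \<mu> :: real
  assumes finite_E: "finite E" and E_ne: "E \<noteq> {}" and mu_pos: "0 < \<mu>"
    and indep_X: "indep_vars (\<lambda>_. count_space UNIV) (\<lambda>(e, k). X e k) (E \<times> {..<n})"
    and distr_X: "e \<in> E \<Longrightarrow> k < n \<Longrightarrow>
      distr M (count_space UNIV) (X e k) = measure_pmf (poisson_pmf \<mu>)"
begin

section \<open>Arrival probabilities in one time interval\<close>

lemma measurable_X: "e \<in> E \<Longrightarrow> k < n \<Longrightarrow> X e k \<in> measurable M (count_space UNIV)"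
  using indep_X by (auto simp: indep_vars_def)

lemma prob_X: "e \<in> E \<Longrightarrow> k < n \<Longrightarrow> prob (X e k -` {a} \<inter> space M) = \<mu> ^ a / fact a * exp (- \<mu>)"
  using measure_distr[OF measurable_X, of e k "{a}"] mu_pos
  by (simp add: distr_X measure_pmf_single)

lemma prob_X_all:
  assumes "k < n"
  shows "prob {\<omega>\<in>space M. \<forall>e\<in>E. X e k \<omega> = a e} = (\<Prod>e\<in>E. \<mu> ^ a e / fact (a e) * exp (- \<mu>))"
proof -
  have "{\<omega>\<in>space M. \<forall>e\<in>E. X e k \<omega> = a e}
      = (\<Inter>b\<in>E \<times> {k}. (case b of (e, k) \<Rightarrow> X e k) -` {a (fst b)} \<inter> space M)"
    using E_ne by auto
  also have "prob \<dots> = (\<Prod>b\<in>E \<times> {k}. prob ((case b of (e, k) \<Rightarrow> X e k) -` {a (fst b)} \<inter> space M))"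
    by (rule indep_varsD[OF indep_X]) (use finite_E E_ne assms in auto)
  also have "\<dots> = (\<Prod>e\<in>E. prob (X e k -` {a e} \<inter> space M))"
    by (rule prod.reindex_cong[of "\<lambda>e. (e, k)"]) (auto simp: inj_on_def)
  also have "\<dots> = (\<Prod>e\<in>E. \<mu> ^ a e / fact (a e) * exp (- \<mu>))"
    using assms by (intro prod.cong) (auto simp: prob_X)
  finally show ?thesis .
qed

text \<open>The probability that a given edge has exactly one arrival in an interval and every other
  edge has none.\<close>

definition p :: real where "p = \<mu> * exp (- (card E * \<mu>))"

lemma prob_no_arrival:
  assumes "k < n"
  shows "prob {\<omega>\<in>space M. \<forall>e\<in>E. X e k \<omega> = 0} = exp (- (card E * \<mu>))"
  using prob_X_all[OF assms, of "\<lambda>_. 0"] by (simp add: exp_of_nat_mult[symmetric])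

lemma prob_single_arrival:
  assumes "k < n" "e \<in> E"
  shows "prob {\<omega>\<in>space M. \<forall>e'\<in>E. X e' k \<omega> = of_bool (e' = e)} = p"
proof -
  have "prob {\<omega>\<in>space M. \<forall>e'\<in>E. X e' k \<omega> = of_bool (e' = e)}
      = (\<Prod>e'\<in>E. (if e' = e then \<mu> else 1) * exp (- \<mu>))"
    unfolding prob_X_all[OF assms(1)] by (intro prod.cong) auto
  also have "\<dots> = p"
    unfolding prod.distrib using assms(2) finite_E
    by (simp add: p_def exp_of_nat_mult[symmetric])
  finally show ?thesis .
qed

text \<open>With \<open>x = card E * \<mu>\<close> the probability is
  \<open>1 - (1 + x) * exp (- x)\<close>, and \<open>exp (- x) \<ge> 1 - x\<close>. The second order
  in \<open>\<mu>\<close> lets a union bound over \<open>n\<close> intervals vanish when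
  \<open>\<mu>\<close> is proportional to \<open>1 / n\<close>.\<close>

lemma prob_multiple_arrivals:
  assumes k: "k < n"
  shows "prob {\<omega>\<in>space M. \<not> ((\<forall>e\<in>E. X e k \<omega> = 0) \<or> (\<exists>e\<in>E. \<forall>e'\<in>E. X e' k \<omega> = of_bool (e' = e)))}
    \<le> (card E * \<mu>)\<^sup>2"
proof -
  define Z where "Z = {\<omega>\<in>space M. \<forall>e\<in>E. X e k \<omega> = 0}"
  define O1 where "O1 e = {\<omega>\<in>space M. \<forall>e'\<in>E. X e' k \<omega> = of_bool (e' = e)}" for e
  have [measurable]: "X e k \<in> measurable M (count_space UNIV)" if "e \<in> E" for e
    using measurable_X[OF that k] .
  have meas: "{\<omega>\<in>space M. \<forall>e\<in>E. X e k \<omega> = a e} \<in> events" for a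
    using finite_E by measurable
  have Z: "Z \<in> events" unfolding Z_def using meas[of "\<lambda>_. 0"] by simp
  have O1: "O1 e \<in> events" for e unfolding O1_def using meas[of "\<lambda>e'. of_bool (e' = e)"] by simp
  have disj: "Z \<inter> (\<Union>e\<in>E. O1 e) = {}" by (auto simp: Z_def O1_def)
  have fam: "disjoint_family_on O1 E"
    by (auto simp: disjoint_family_on_def O1_def)
  have "{\<omega>\<in>space M. \<not> ((\<forall>e\<in>E. X e k \<omega> = 0) \<or> (\<exists>e\<in>E. \<forall>e'\<in>E. X e' k \<omega> = of_bool (e' = e)))}
      = space M - (Z \<union> (\<Union>e\<in>E. O1 e))"
    by (auto simp: Z_def O1_def)
  moreover have UN: "(\<Union>e\<in>E. O1 e) \<in> events" using O1 finite_E by auto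
  moreover have "prob (space M - (Z \<union> (\<Union>e\<in>E. O1 e))) = 1 - prob (Z \<union> (\<Union>e\<in>E. O1 e))"
    using Z UN by (intro prob_compl) auto
  moreover have "prob (Z \<union> (\<Union>e\<in>E. O1 e)) = prob Z + (\<Sum>e\<in>E. prob (O1 e))"
    unfolding finite_measure_Union[OF Z UN disj]
    by (subst finite_measure_finite_Union) (use O1 finite_E fam in auto)
  moreover have "prob Z + (\<Sum>e\<in>E. prob (O1 e)) = (1 + card E * \<mu>) * exp (- (card E * \<mu>))"
    using prob_no_arrival[OF k] prob_single_arrival[OF k]
    by (simp add: Z_def O1_def p_def algebra_simps)
  moreover have "(1 + card E * \<mu>) * exp (- (card E * \<mu>)) \<ge> (1 + card E * \<mu>) * (1 - card E * \<mu>)"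
    using exp_ge_add_one_self[of "- (card E * \<mu>)"] mu_pos by (intro mult_left_mono) auto
  ultimately show ?thesis by (simp add: power2_eq_square algebra_simps)
qed

section \<open>The edge chosen in each interval\<close>

definition single :: "('e \<Rightarrow> nat) \<Rightarrow> 'e \<Rightarrow> bool" where
  "single f e \<longleftrightarrow> e \<in> E \<and> (\<forall>e'\<in>E. f e' = of_bool (e' = e))"

lemma single_unique: "single f d \<Longrightarrow> single f e \<Longrightarrow> d = e"
  unfolding single_def of_bool_def by (metis zero_neq_one)

text \<open>\<open>None\<close> stands both for no arrival and for several ones.\<close>

definition choice :: "('e \<Rightarrow> nat) \<Rightarrow> 'e option" where
  "choice f = (if \<exists>e. single f e then Some (SOME e. single f e) else None)"

lemma choice_eq_Some: "choice f = Some e \<longleftrightarrow> single f e"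
proof (cases "\<exists>e. single f e")
  case True
  then have "single f (SOME e. single f e)" by (rule someI_ex)
  then show ?thesis using True single_unique[of f] unfolding choice_def by auto
next
  case False
  then show ?thesis by (simp add: choice_def)
qed

abbreviation choices :: "'e option set" where "choices \<equiv> insert None (Some ` E)"

lemma choice_in: "choice f \<in> choices"
  using choice_eq_Some[of f] by (cases "choice f") (auto simp: single_def)

definition C :: "nat \<Rightarrow> 'w \<Rightarrow> 'e option" where "C k \<omega> = choice (\<lambda>e. X e k \<omega>)"

text \<open>\<open>C k\<close> reads only the counts of interval \<open>k\<close>, and different
  intervals use disjoint blocks of the independent family.\<close>

lemma indep_C: "indep_vars (\<lambda>_. count_space choices) C {..<n}"
proof -
  have 1: "indep_vars (\<lambda>k. PiM (E \<times> {k}) (\<lambda>_. count_space UNIV))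
      (\<lambda>k \<omega>. \<lambda>a\<in>E \<times> {k}. (case a of (e, k) \<Rightarrow> X e k) \<omega>) {..<n}"
    by (rule indep_vars_restrict[OF indep_X]) (auto simp: disjoint_family_on_def)
  have 2: "(\<lambda>f. choice (\<lambda>e. f (e, k))) \<in> measurable (PiM (E \<times> {k}) (\<lambda>_. count_space (UNIV :: nat set))) (count_space choices)"
    for k
    by (subst count_space_PiM_finite) (use finite_E choice_in in auto)
  have "indep_vars (\<lambda>_. count_space choices)
      (\<lambda>k \<omega>. choice (\<lambda>e. (\<lambda>a\<in>E \<times> {k}. (case a of (e, k) \<Rightarrow> X e k) \<omega>) (e, k))) {..<n}"
    by (rule indep_vars_compose2[OF 1 2])
  moreover have "choice (\<lambda>e. (\<lambda>a\<in>E \<times> {k}. (case a of (e, k) \<Rightarrow> X e k) \<omega>) (e, k)) = C k \<omega>" for k \<omega>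
    unfolding C_def choice_def single_def by (simp cong: ball_cong conj_cong)
  ultimately show ?thesis by (simp cong: indep_vars_cong)
qed

lemma prob_C:
  assumes "k < n" "e \<in> E"
  shows "prob (C k -` {Some e} \<inter> space M) = p"
proof -
  have "C k -` {Some e} \<inter> space M = {\<omega>\<in>space M. \<forall>e'\<in>E. X e' k \<omega> = of_bool (e' = e)}"
    using assms(2) by (auto simp: C_def choice_eq_Some single_def)
  then show ?thesis using prob_single_arrival[OF assms] by simp
qed

lemma measurable_C: "k < n \<Longrightarrow> C k \<in> measurable M (count_space choices)"
  using indep_C by (auto simp: indep_vars_def)

text \<open>Intervals with several arrivals count as rest, so the choices have exactly the law of
  the steps of the chain; the discrepancy appears only when paths are compared.\<close>

lemma prob_C_None:
  assumes "k < n"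
  shows "prob (C k -` {None} \<inter> space M) = 1 - card E * p"
proof -
  note [measurable] = measurable_C[OF assms]
  have "C k -` {None} \<inter> space M = space M - (\<Union>e\<in>E. C k -` {Some e} \<inter> space M)"
    by (auto simp: C_def) (metis choice_in imageE insertE)
  moreover have ev: "C k -` {Some e} \<inter> space M \<in> events" if "e \<in> E" for e
    by (rule measurable_sets[OF measurable_C[OF assms]]) (use that in auto)
  moreover have "prob (space M - (\<Union>e\<in>E. C k -` {Some e} \<inter> space M))
      = 1 - prob (\<Union>e\<in>E. C k -` {Some e} \<inter> space M)"
    by (intro prob_compl sets.finite_UN finite_E ev)
  ultimately have "prob (C k -` {None} \<inter> space M) = 1 - prob (\<Union>e\<in>E. C k -` {Some e} \<inter> space M)"
    by (simp only:)
  also have "prob (\<Union>e\<in>E. C k -` {Some e} \<inter> space M) = (\<Sum>e\<in>E. prob (C k -` {Some e} \<inter> space M))"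
    by (rule finite_measure_finite_Union) (use finite_E ev in \<open>auto simp: disjoint_family_on_def\<close>)
  finally show ?thesis using prob_C[OF assms] by simp
qed

section \<open>Histories of choices\<close>

definition hist :: "nat \<Rightarrow> 'w \<Rightarrow> 'e option list" where
  "hist k \<omega> = map (\<lambda>i. C i \<omega>) [0..<k]"

lemma hist_Suc: "hist (Suc k) \<omega> = hist k \<omega> @ [C k \<omega>]"
  by (simp add: hist_def)

lemma finite_choices: "finite choices"
  using finite_E by simp

lemma hist_in: "hist k \<omega> \<in> {l. set l \<subseteq> choices \<and> length l = k}"
  using choice_in by (auto simp: hist_def C_def)

text \<open>The history before interval \<open>k\<close> is a function of the earlier choices, hence
  independent of \<open>C k\<close>. Integrability holds because histories range over finitely many
  lists.\<close>

lemma
  fixes \<Psi> :: "'e option list \<Rightarrow> real"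
  assumes k: "k < n" and a: "a \<in> choices"
  shows expectation_C_hist: "expectation (\<lambda>\<omega>. of_bool (C k \<omega> = a) * \<Psi> (hist k \<omega>))
      = prob (C k -` {a} \<inter> space M) * expectation (\<lambda>\<omega>. \<Psi> (hist k \<omega>))"
    and integrable_C_hist: "integrable M (\<lambda>\<omega>. of_bool (C k \<omega> = a) * \<Psi> (hist k \<omega>))"
proof -
  let ?P = "\<lambda>A. PiM A (\<lambda>_. count_space choices)"
  have P: "?P A = count_space (A \<rightarrow>\<^sub>E choices)" if "finite A" for A :: "nat set"
    by (rule count_space_PiM_finite[OF that]) (simp add: finite_E countable_finite)
  have *: "indep_var (?P {k}) (\<lambda>\<omega>. \<lambda>i\<in>{k}. C i \<omega>) (?P {..<k}) (\<lambda>\<omega>. \<lambda>i\<in>{..<k}. C i \<omega>)"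
    by (rule indep_var_restrict[OF indep_C]) (use k in auto)
  have "indep_var borel ((\<lambda>f. of_bool (f k = a) :: real) \<circ> (\<lambda>\<omega>. \<lambda>i\<in>{k}. C i \<omega>))
      borel ((\<lambda>f. \<Psi> (map f [0..<k])) \<circ> (\<lambda>\<omega>. \<lambda>i\<in>{..<k}. C i \<omega>))"
    by (rule indep_var_compose[OF *]) (simp_all add: P)
  moreover have "map (\<lambda>i\<in>{..<k}. C i \<omega>) [0..<k] = hist k \<omega>" for \<omega>
    by (simp add: hist_def)
  ultimately have ind: "indep_var borel (\<lambda>\<omega>. of_bool (C k \<omega> = a) :: real) borel (\<lambda>\<omega>. \<Psi> (hist k \<omega>))"
    by (simp add: comp_def)
  have fin: "finite {l. set l \<subseteq> choices \<and> length l = k}"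
    by (rule finite_lists_length_eq[OF finite_choices])
  have m: "(\<lambda>\<omega>. of_bool (C k \<omega> = a) :: real) \<in> borel_measurable M" "(\<lambda>\<omega>. \<Psi> (hist k \<omega>)) \<in> borel_measurable M"
    using indep_var_rv1[OF ind] indep_var_rv2[OF ind] by auto
  have i1: "integrable M (\<lambda>\<omega>. of_bool (C k \<omega> = a) :: real)"
    by (rule integrable_const_bound[where B = 1]) (use m in auto)
  have i2: "integrable M (\<lambda>\<omega>. \<Psi> (hist k \<omega>))"
  proof (rule integrable_const_bound)
    show "AE \<omega> in M. norm (\<Psi> (hist k \<omega>)) \<le> (\<Sum>l | set l \<subseteq> choices \<and> length l = k. \<bar>\<Psi> l\<bar>)"
    proof (rule AE_I2)
      fix \<omega>
      show "norm (\<Psi> (hist k \<omega>)) \<le> (\<Sum>l | set l \<subseteq> choices \<and> length l = k. \<bar>\<Psi> l\<bar>)"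
        unfolding real_norm_def by (rule member_le_sum[OF hist_in _ fin]) auto
    qed
  qed (use m in auto)
  have "expectation (\<lambda>\<omega>. of_bool (C k \<omega> = a) :: real) = expectation (indicator (C k -` {a} \<inter> space M))"
    by (intro Bochner_Integration.integral_cong) (auto simp: indicator_def)
  also have "\<dots> = prob (C k -` {a} \<inter> space M)"
    using measurable_sets[OF measurable_C[OF k], of "{a}"] a by simp
  finally show "expectation (\<lambda>\<omega>. of_bool (C k \<omega> = a) * \<Psi> (hist k \<omega>))
      = prob (C k -` {a} \<inter> space M) * expectation (\<lambda>\<omega>. \<Psi> (hist k \<omega>))"
    using indep_var_lebesgue_integral[OF ind i1 i2] by simp
  show "integrable M (\<lambda>\<omega>. of_bool (C k \<omega> = a) * \<Psi> (hist k \<omega>))"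
    by (rule indep_var_integrable[OF ind i1 i2])
qed

lemma expectation_hist_Suc:
  fixes \<Psi> :: "'e option list \<Rightarrow> real"
  assumes k: "k < n"
  shows "expectation (\<lambda>\<omega>. \<Psi> (hist (Suc k) \<omega>))
      = (1 - card E * p) * expectation (\<lambda>\<omega>. \<Psi> (hist k \<omega> @ [None]))
        + p * (\<Sum>e\<in>E. expectation (\<lambda>\<omega>. \<Psi> (hist k \<omega> @ [Some e])))"
proof -
  have "\<Psi> (hist (Suc k) \<omega>) = (\<Sum>a\<in>choices. of_bool (C k \<omega> = a) * \<Psi> (hist k \<omega> @ [a]))" for \<omega>
  proof -
    have "(\<Sum>a\<in>choices. of_bool (C k \<omega> = a) * \<Psi> (hist k \<omega> @ [a]))
        = (\<Sum>a\<in>choices. if a = C k \<omega> then \<Psi> (hist k \<omega> @ [C k \<omega>]) else 0)"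
      by (intro sum.cong) auto
    then show ?thesis
      using choice_in[of "\<lambda>e. X e k \<omega>"] finite_choices by (simp only: sum.delta C_def hist_Suc if_True)
  qed
  then have "expectation (\<lambda>\<omega>. \<Psi> (hist (Suc k) \<omega>))
      = (\<Sum>a\<in>choices. expectation (\<lambda>\<omega>. of_bool (C k \<omega> = a) * \<Psi> (hist k \<omega> @ [a])))"
    using integrable_C_hist[OF k, where \<Psi> = "\<lambda>l. \<Psi> (l @ [_])"]
    by (simp only: Bochner_Integration.integral_sum)
  also have "\<dots> = (\<Sum>a\<in>choices. prob (C k -` {a} \<inter> space M) * expectation (\<lambda>\<omega>. \<Psi> (hist k \<omega> @ [a])))"
    by (intro sum.cong refl expectation_C_hist[OF k, where \<Psi> = "\<lambda>l. \<Psi> (l @ [_])"])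
  also have "\<dots> = (1 - card E * p) * expectation (\<lambda>\<omega>. \<Psi> (hist k \<omega> @ [None]))
        + p * (\<Sum>e\<in>E. expectation (\<lambda>\<omega>. \<Psi> (hist k \<omega> @ [Some e])))"
    using finite_E by (simp add: sum.reindex prob_C[OF k] prob_C_None[OF k] sum_distrib_left)
  finally show ?thesis .
qed

lemma measurable_hist:
  fixes \<Psi> :: "'e option list \<Rightarrow> real"
  assumes k: "k \<le> n"
  shows "(\<lambda>\<omega>. \<Psi> (hist k \<omega>)) \<in> borel_measurable M"
proof -
  have "(\<lambda>\<omega>. \<lambda>i\<in>{..<k}. C i \<omega>) \<in> measurable M (PiM {..<k} (\<lambda>_. count_space choices))"
    using k by (intro measurable_restrict measurable_C) auto
  moreover have "PiM {..<k} (\<lambda>_. count_space choices) = count_space ({..<k} \<rightarrow>\<^sub>E choices)"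
    by (rule count_space_PiM_finite) (simp_all add: finite_E countable_finite)
  ultimately have "(\<lambda>f. \<Psi> (map f [0..<k])) \<circ> (\<lambda>\<omega>. \<lambda>i\<in>{..<k}. C i \<omega>) \<in> borel_measurable M"
    by (intro measurable_comp[where N = "count_space ({..<k} \<rightarrow>\<^sub>E choices)"]) simp_all
  moreover have "map (\<lambda>i\<in>{..<k}. C i \<omega>) [0..<k] = hist k \<omega>" for \<omega>
    by (simp add: hist_def)
  ultimately show ?thesis by (simp add: comp_def)
qed

end

section \<open>The torus and the paths of the averaging process\<close>

text \<open>Translation vectors come from the whole lattice, because the inverse of translation by
  \<open>y\<close> is translation by \<open>- y\<close>, which may leave \<open>[0,1)\<close> in
  some coordinate.\<close>

definition grid :: "real \<Rightarrow> (real ^ 'd) set" where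
  "grid \<epsilon> = {x. \<forall>j. \<exists>k::int. x $ j = \<epsilon> * of_int k}"

definition translate :: "real ^ 'd \<Rightarrow> real ^ 'd \<Rightarrow> real ^ 'd" where
  "translate y x = (\<chi> j. frac (x $ j + y $ j))"

lemma shift_translate: "shift \<epsilon> i = translate (\<epsilon> *\<^sub>R axis i 1)"
  by (simp add: fun_eq_iff shift_def translate_def)

lemma frac_frac_add: "frac (frac a + b) = frac (a + b)" for a b :: real
proof -
  have "frac (x - of_int k) = frac x" for x :: real and k :: int
    by (simp add: frac_def)
  then have "frac (a + b - of_int \<lfloor>a\<rfloor>) = frac (a + b)" .
  moreover have "frac a + b = a + b - of_int \<lfloor>a\<rfloor>" by (simp add: frac_def)
  ultimately show ?thesis by (simp only:)
qed

lemma translate_translate: "translate y (translate z x) = translate (y + z) x"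
  by (simp add: translate_def frac_frac_add vec_eq_iff ac_simps)

lemma translate_commute: "translate y (translate z x) = translate z (translate y x)"
  by (simp add: translate_translate add.commute)

context
  fixes \<epsilon> :: real
  assumes \<epsilon>: "0 < \<epsilon>" "1 / \<epsilon> \<in> \<nat>"
begin

text \<open>Since \<open>1 / \<epsilon>\<close> is a natural number, \<open>1\<close> is a multiple
  of \<open>\<epsilon>\<close>, so removing integer parts does not leave the lattice.\<close>

lemma translate_torus:
  assumes "x \<in> grid \<epsilon>" "y \<in> grid \<epsilon>"
  shows "translate y x \<in> torus \<epsilon>"
proof -
  obtain n :: nat where "1 / \<epsilon> = n" using \<epsilon>(2) by (auto elim: Nats_cases)
  then have n: "1 = \<epsilon> * n" using \<epsilon>(1) by (simp add: field_simps)
  have "\<exists>k::int. frac (x $ j + y $ j) = \<epsilon> * of_int k" for j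
  proof -
    obtain k l :: int where "x $ j = \<epsilon> * of_int k" "y $ j = \<epsilon> * of_int l"
      using assms unfolding grid_def by blast
    then have "frac (x $ j + y $ j) = \<epsilon> * of_int k + \<epsilon> * of_int l - 1 * of_int \<lfloor>x $ j + y $ j\<rfloor>"
      by (simp add: frac_def)
    also have "\<dots> = \<epsilon> * of_int (k + l - int n * \<lfloor>x $ j + y $ j\<rfloor>)"
      by (subst n) (simp add: algebra_simps)
    finally show ?thesis by blast
  qed
  then show ?thesis by (simp add: torus_def translate_def frac_lt_1)
qed

lemma torus_grid: "torus \<epsilon> \<subseteq> grid \<epsilon>"
  by (auto simp: torus_def grid_def)

lemma axis_grid: "\<epsilon> *\<^sub>R axis i 1 \<in> grid \<epsilon>"
  unfolding grid_def by (auto simp: axis_def intro: exI[of _ 1] exI[of _ 0])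

lemma bij_translate:
  assumes y: "y \<in> grid \<epsilon>"
  shows "bij_betw (translate y) (torus \<epsilon>) (torus \<epsilon>)"
proof (rule bij_betw_byWitness[where f' = "translate (- y)"])
  have y': "- y \<in> grid \<epsilon>"
    unfolding grid_def
  proof safe
    fix j
    obtain k :: int where "y $ j = \<epsilon> * of_int k" using y unfolding grid_def by blast
    then show "\<exists>k::int. (- y) $ j = \<epsilon> * of_int k" by (intro exI[of _ "- k"]) simp
  qed
  have "translate 0 x = x" if "x \<in> torus \<epsilon>" for x :: "real ^ 'a"
    using that by (simp add: translate_def torus_def vec_eq_iff frac_eq)
  then show "\<forall>x\<in>torus \<epsilon>. translate (- y) (translate y x) = x"
    and "\<forall>x\<in>torus \<epsilon>. translate y (translate (- y) x) = x"
    by (auto simp: translate_translate)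
  show "translate y ` torus \<epsilon> \<subseteq> torus \<epsilon>" and "translate (- y) ` torus \<epsilon> \<subseteq> torus \<epsilon>"
    using translate_torus y y' torus_grid by blast+
qed

lemma finite_torus: "finite (torus \<epsilon> :: (real ^ 'd) set)"
proof -
  obtain n :: nat where "1 / \<epsilon> = n" using \<epsilon>(2) by (auto elim: Nats_cases)
  then have n: "1 = \<epsilon> * n" using \<epsilon>(1) by (simp add: field_simps)
  let ?F = "PiE (UNIV :: 'd set) (\<lambda>_. (\<lambda>k. \<epsilon> * of_int k) ` {0..<int n})"
  have "torus \<epsilon> \<subseteq> vec_lambda ` ?F"
  proof
    fix x :: "real ^ 'd" assume x: "x \<in> torus \<epsilon>"
    have "x $ j \<in> (\<lambda>k. \<epsilon> * of_int k) ` {0..<int n}" for j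
    proof -
      obtain k :: int where k: "x $ j = \<epsilon> * of_int k"
        using x unfolding torus_def by auto
      moreover have "0 \<le> x $ j" "x $ j < \<epsilon> * n"
        using x unfolding torus_def n[symmetric] by auto
      ultimately have "0 \<le> k" "k < int n" using \<epsilon>(1)
        by (auto simp: zero_le_mult_iff)
      then show ?thesis using k by auto
    qed
    then have "(\<lambda>j. x $ j) \<in> ?F" by auto
    then show "x \<in> vec_lambda ` ?F" by (metis image_eqI vec_lambda_eta)
  qed
  then show ?thesis by (rule finite_subset) (intro finite_imageI finite_PiE, auto)
qed

lemma zero_torus: "0 \<in> torus \<epsilon>"
  by (auto simp: torus_def intro: exI[of _ 0])

lemma shift_torus: "x \<in> torus \<epsilon> \<Longrightarrow> shift \<epsilon> i x \<in> torus \<epsilon>"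
  unfolding shift_translate using translate_torus axis_grid torus_grid by blast

lemma edge_averaging_torus: "edge_averaging (torus \<epsilon> :: (real ^ 'd) set) (shift \<epsilon>) translate 0"
proof
  show "bij_betw (shift \<epsilon> i) (torus \<epsilon>) (torus \<epsilon>)" for i :: 'd
    unfolding shift_translate by (rule bij_translate[OF axis_grid])
  show "bij_betw (translate y) (torus \<epsilon>) (torus \<epsilon>)" if "y \<in> torus \<epsilon>" for y :: "real ^ 'd"
    using that torus_grid by (intro bij_translate) auto
  show "translate y 0 = y" if "y \<in> torus \<epsilon>" for y :: "real ^ 'd"
    using that by (simp add: translate_def torus_def vec_eq_iff frac_eq)
qed (auto simp: finite_torus zero_torus shift_translate translate_commute)

end

section \<open>Arrivals of right-continuous counting paths\<close>

lemma eventually_at_right_eq: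
  fixes \<nu> :: "real \<Rightarrow> nat"
  assumes "continuous (at_right t) \<nu>"
  shows "eventually (\<lambda>s. \<nu> s = \<nu> t) (at_right t)"
  using assms by (simp add: continuous_within tendsto_discrete)

lemma arrivalsD: "q \<in> arrivals \<nu> \<Longrightarrow> 0 \<le> s \<Longrightarrow> s < q \<Longrightarrow> \<nu> s < \<nu> q"
  by (simp add: arrivals_def)

lemma arrivals_empty:
  assumes "mono_on {0..} \<nu>" "0 \<le> s" "\<nu> r = \<nu> s"
  shows "arrivals \<nu> \<inter> {s<..r} = {}"
proof -
  have "\<nu> \<tau> \<le> \<nu> s" if "s < \<tau>" "\<tau> \<le> r" for \<tau>
    using mono_onD[OF assms(1), of \<tau> r] assms that by auto
  moreover have "\<nu> s < \<nu> \<tau>" if "\<tau> \<in> arrivals \<nu>" "s < \<tau>" for \<tau>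
    by (rule arrivalsD[OF that(1) assms(2) that(2)])
  ultimately have "\<not> (\<tau> \<in> arrivals \<nu> \<and> s < \<tau> \<and> \<tau> \<le> r)" for \<tau>
    using linorder_not_less by metis
  then show ?thesis by auto
qed

text \<open>The arrival is the infimum of the times at which the count has its final value; it is
  attained because an integer-valued right-continuous path is locally constant to the right. A
  second arrival would need a further unit of increase.\<close>

lemma arrivals_single:
  assumes mono: "mono_on {0..} \<nu>" and cont: "\<And>t. 0 \<le> t \<Longrightarrow> continuous (at_right t) \<nu>"
    and s: "0 \<le> s" "s < r" and jump: "\<nu> r = Suc (\<nu> s)"
  shows "\<exists>\<tau>. s < \<tau> \<and> \<tau> \<le> r \<and> arrivals \<nu> \<inter> {s<..r} = {\<tau>}"
proof -
  define A where "A = {q\<in>{s..r}. \<nu> q = \<nu> r}"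
  define \<tau> where "\<tau> = Inf A"
  have rA: "r \<in> A" using s by (simp add: A_def)
  have bdd: "bdd_below A" by (auto simp: A_def intro: bdd_belowI[of _ s])
  have le: "\<tau> \<le> r" unfolding \<tau>_def by (rule cInf_lower[OF rA bdd])
  have ge: "s \<le> \<tau>" unfolding \<tau>_def by (rule cInf_greatest) (use rA in \<open>auto simp: A_def\<close>)
  have mono': "\<nu> a \<le> \<nu> b" if "0 \<le> a" "a \<le> b" for a b
    using mono_onD[OF mono, of a b] that by auto
  have \<tau>: "\<nu> \<tau> = \<nu> r"
  proof (cases "\<tau> = r")
    case False
    have ev: "eventually (\<lambda>q. \<nu> q = \<nu> \<tau>) (at_right \<tau>)"
      using ge s by (intro eventually_at_right_eq cont) auto
    then obtain b where b: "b > \<tau>" "\<And>q. \<tau> < q \<Longrightarrow> q < b \<Longrightarrow> \<nu> q = \<nu> \<tau>"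
      unfolding eventually_at_right_field by blast
    obtain q where q: "q \<in> A" "q < b"
      using b(1) unfolding \<tau>_def using cInf_lessD[of A b] rA by auto
    have "\<tau> \<le> q" unfolding \<tau>_def by (rule cInf_lower[OF q(1) bdd])
    then have "\<nu> q = \<nu> \<tau>" using b(2)[of q] q by (cases "q = \<tau>") auto
    then show ?thesis using q by (simp add: A_def)
  qed simp
  have "\<tau> \<noteq> s" using \<tau> jump by auto
  then have gt: "s < \<tau>" using ge by simp
  have below: "\<nu> q = \<nu> s" if "s \<le> q" "q < \<tau>" for q
  proof -
    have "q \<notin> A" using that(2) cInf_lower[OF _ bdd, of q] unfolding \<tau>_def by auto
    then have "\<nu> q \<noteq> \<nu> r" using that le by (auto simp: A_def)
    moreover have "\<nu> s \<le> \<nu> q" "\<nu> q \<le> \<nu> r" using mono' that le s by auto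
    ultimately show ?thesis using jump by simp
  qed
  have \<tau>_arr: "\<tau> \<in> arrivals \<nu>"
    unfolding arrivals_def
  proof (safe)
    show "0 < \<tau>" using gt s by simp
    fix q assume q: "0 \<le> q" "q < \<tau>"
    have "\<nu> q \<le> \<nu> s"
    proof (cases "s \<le> q")
      case True
      then show ?thesis using below[OF True q(2)] by simp
    next
      case False
      then show ?thesis using mono' q by simp
    qed
    then show "\<nu> q < \<nu> \<tau>" using \<tau> jump by simp
  qed
  have uniq: "q = \<tau>" if q: "q \<in> arrivals \<nu>" "s < q" "q \<le> r" for q
  proof (rule ccontr)
    assume "q \<noteq> \<tau>"
    then consider "q < \<tau>" | "\<tau> < q" by linarith
    then show False
    proof cases
      case 1
      then have "\<nu> q = \<nu> s" by (intro below) (use q in auto)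
      then show False using arrivalsD[OF q(1) s(1) q(2)] by simp
    next
      case 2
      then have "\<nu> \<tau> < \<nu> q" using gt s by (intro arrivalsD[OF q(1)]) auto
      then show False using mono'[of q r] q s \<tau> by simp
    qed
  qed
  have "arrivals \<nu> \<inter> {s<..r} \<subseteq> {\<tau>}"
  proof
    fix q assume "q \<in> arrivals \<nu> \<inter> {s<..r}"
    then have "q = \<tau>" by (intro uniq) auto
    then show "q \<in> {\<tau>}" by simp
  qed
  then have "arrivals \<nu> \<inter> {s<..r} = {\<tau>}"
    using \<tau>_arr gt le by auto
  then show ?thesis using gt le by (intro exI[of _ \<tau>] conjI)
qed

text \<open>The count increases strictly along arrivals, so it injects them into
  \<open>{..\<nu> r}\<close>.\<close>

lemma finite_arrivals:
  assumes mono: "mono_on {0..} \<nu>"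
  shows "finite (arrivals \<nu> \<inter> {..r})"
proof (rule inj_on_finite)
  show "inj_on \<nu> (arrivals \<nu> \<inter> {..r})"
  proof (rule linorder_inj_onI')
    fix a b assume ab: "a \<in> arrivals \<nu> \<inter> {..r}" "b \<in> arrivals \<nu> \<inter> {..r}" "a < b"
    have "b \<in> arrivals \<nu>" "0 \<le> a" using ab by (auto simp: arrivals_def)
    then have "\<nu> a < \<nu> b" using ab(3) by (rule arrivalsD)
    then show "\<nu> a \<noteq> \<nu> b" by simp
  qed
  show "\<nu> ` (arrivals \<nu> \<inter> {..r}) \<subseteq> {..\<nu> r}"
    using mono_onD[OF mono, of _ r] by (auto simp: arrivals_def)
qed simp

section \<open>Pathwise properties of the averaging process\<close>

lemma averaging_path_rest:
  assumes path: "averaging_path \<epsilon> \<nu> u0 u" and s: "0 \<le> s" "s \<le> r"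
    and none: "\<And>x i. x \<in> torus \<epsilon> \<Longrightarrow> arrivals (\<nu> (x, i)) \<inter> {s<..r} = {}" and y: "y \<in> torus \<epsilon>"
  shows "u r y = u s y"
proof (cases "s = r")
  case False
  then show ?thesis using path s none y unfolding averaging_path_def by (meson order_le_neq_trans)
qed simp

lemma averaging_path_left_limit:
  assumes path: "averaging_path \<epsilon> \<nu> u0 u" and s: "0 \<le> s" "s < \<tau>"
    and none: "\<And>x i. x \<in> torus \<epsilon> \<Longrightarrow> arrivals (\<nu> (x, i)) \<inter> {s<..<\<tau>} = {}" and z: "z \<in> torus \<epsilon>"
  shows "Lim (at_left \<tau>) (\<lambda>q. u q z) = u s z"
proof (rule tendsto_Lim)
  have "u q z = u s z" if "s < q" "q < \<tau>" for q
    by (rule averaging_path_rest[OF path]) (use that s none z in \<open>force+\<close>)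
  then show "((\<lambda>q. u q z) \<longlongrightarrow> u s z) (at_left \<tau>)"
    using s by (intro tendsto_eventually) (auto simp: eventually_at_left_field)
qed simp

lemma averaging_path_single:
  assumes \<epsilon>: "0 < \<epsilon>" "1 / \<epsilon> \<in> \<nat>"
    and path: "averaging_path \<epsilon> \<nu> u0 u" and s: "0 \<le> s" "s < \<tau>" "\<tau> \<le> r"
    and x: "x \<in> torus \<epsilon>" and one: "arrivals (\<nu> (x, i)) \<inter> {s<..r} = {\<tau>}"
    and none: "\<And>a. a \<in> torus \<epsilon> \<times> UNIV \<Longrightarrow> a \<noteq> (x, i) \<Longrightarrow> arrivals (\<nu> a) \<inter> {s<..r} = {}"
    and y: "y \<in> torus \<epsilon>"
  shows "u r y = average \<epsilon> i x (u s) y"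
proof -
  have arr: "arrivals (\<nu> (z, j)) \<inter> {s<..r} \<subseteq> {\<tau>}" if "z \<in> torus \<epsilon>" for z j
    using one none[of "(z, j)"] that by (cases "(z, j) = (x, i)") auto
  have sub: "q = \<tau>" if "z \<in> torus \<epsilon>" "q \<in> arrivals (\<nu> (z, j))" "s < q" "q \<le> r" for z j q
    using subsetD[OF arr[OF that(1)], of q j] that by simp
  have "u r y = u \<tau> y"
    by (rule averaging_path_rest[OF path _ s(3) _ y]) (use sub s in \<open>force+\<close>)
  also have "\<tau> \<in> arrivals (\<nu> (x, i))" using one by auto
  then have "u \<tau> y = average \<epsilon> i x (\<lambda>z. Lim (at_left \<tau>) (\<lambda>q. u q z)) y"
    using path x y unfolding averaging_path_def by blast
  also have "\<dots> = average \<epsilon> i x (u s) y"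
  proof -
    have "Lim (at_left \<tau>) (\<lambda>q. u q z) = u s z" if "z \<in> torus \<epsilon>" for z
      by (rule averaging_path_left_limit[OF path s(1,2) _ that]) (use sub s in \<open>force+\<close>)
    then show ?thesis using x y shift_torus[OF \<epsilon> x] by (simp add: average_def)
  qed
  finally show ?thesis .
qed

text \<open>This controls paths with several arrivals in one interval, which the chain does not
  describe. The induction is on the number of arrivals up to time \<open>s\<close> over all edges:
  at the latest one the values are left limits or means of two left limits, and these inherit the
  bound from earlier times with fewer arrivals.\<close>

lemma averaging_path_bound:
  fixes u0 :: "real ^ 'd \<Rightarrow> real"
  assumes \<epsilon>: "0 < \<epsilon>" "1 / \<epsilon> \<in> \<nat>"
    and path: "averaging_path \<epsilon> \<nu> u0 u"
    and mono: "\<And>x i. x \<in> torus \<epsilon> \<Longrightarrow> mono_on {0..} (\<nu> (x, i))"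
    and bound: "\<And>y. y \<in> torus \<epsilon> \<Longrightarrow> \<bar>u0 y\<bar> \<le> B"
    and "0 \<le> s" "y \<in> torus \<epsilon>"
  shows "\<bar>u s y\<bar> \<le> B"
proof -
  define Arr where "Arr r = (\<Union>a\<in>torus \<epsilon> \<times> UNIV. arrivals (\<nu> a) \<inter> {..r})" for r
  have fin: "finite (Arr r)" for r
    unfolding Arr_def
    by (intro finite_UN_I finite_cartesian_product finite_torus[OF \<epsilon>] finite_class.finite_UNIV
        finite_arrivals) (auto simp: mono)
  show ?thesis using \<open>0 \<le> s\<close> \<open>y \<in> torus \<epsilon>\<close>
  proof (induction "card (Arr s)" arbitrary: s y rule: less_induct)
    case less
    show ?case
    proof (cases "Arr s = {}")
      case True
      have "arrivals (\<nu> (x, i)) \<inter> {0<..s} = {}" if "x \<in> torus \<epsilon>" for x i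
      proof -
        have "arrivals (\<nu> (x, i)) \<inter> {0<..s} \<subseteq> Arr s" using that by (force simp: Arr_def)
        then show ?thesis using True by simp
      qed
      then have "u s y = u 0 y"
        by (rule averaging_path_rest[OF path order.refl less.prems(1) _ less.prems(2)])
      then show ?thesis using path bound less.prems unfolding averaging_path_def by auto
    next
      case False
      define \<tau> where "\<tau> = Max (Arr s)"
      have \<tau>: "\<tau> \<in> Arr s" unfolding \<tau>_def using fin False by (rule Max_in)
      then obtain x i where x: "x \<in> torus \<epsilon>" and arr: "\<tau> \<in> arrivals (\<nu> (x, i))" and "\<tau> \<le> s"
        by (auto simp: Arr_def)
      have "0 < \<tau>" using arr by (simp add: arrivals_def)
      have "q \<le> \<tau>" if "q \<in> Arr s" for q unfolding \<tau>_def by (rule Max_ge[OF fin that])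
      then have "u s y = u \<tau> y"
        using \<open>0 < \<tau>\<close>
        by (intro averaging_path_rest[OF path _ \<open>\<tau> \<le> s\<close> _ less.prems(2)]) (force simp: Arr_def)+
      also have "\<dots> = average \<epsilon> i x (\<lambda>z. Lim (at_left \<tau>) (\<lambda>q. u q z)) y"
        using path x arr less.prems unfolding averaging_path_def by blast
      also have "\<bar>\<dots>\<bar> \<le> B"
      proof -
        have lim: "\<bar>Lim (at_left \<tau>) (\<lambda>q. u q z)\<bar> \<le> B" if z: "z \<in> torus \<epsilon>" for z
        proof -
          \<comment> \<open>The cadlag property supplies a limit, so that \<open>Lim\<close> denotes
            it and the bound passes to it.\<close>
          obtain l where l: "((\<lambda>q. u q z) \<longlongrightarrow> l) (at_left \<tau>)"
            using path z \<open>0 < \<tau>\<close> unfolding averaging_path_def cadlag_def by blast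
          have IH: "\<bar>u q z\<bar> \<le> B" if q: "0 < q" "q < \<tau>" for q
          proof (rule less.hyps)
            have "Arr q \<subset> Arr s" using q \<tau> \<open>\<tau> \<le> s\<close> by (force simp: Arr_def)
            then show "card (Arr q) < card (Arr s)" by (rule psubset_card_mono[OF fin])
          qed (use q z in auto)
          have "\<bar>l\<bar> \<le> B"
          proof (rule tendsto_upperbound[OF tendsto_rabs[OF l]])
            show "eventually (\<lambda>q. \<bar>u q z\<bar> \<le> B) (at_left \<tau>)"
              using IH \<open>0 < \<tau>\<close> by (auto simp: eventually_at_left_field)
          qed simp
          then show ?thesis using tendsto_Lim[OF _ l] by simp
        qed
        have "\<bar>(a + b) / 2\<bar> \<le> B" if "\<bar>a\<bar> \<le> B" "\<bar>b\<bar> \<le> B" for a b :: real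
          using that abs_triangle_ineq[of a b] unfolding abs_divide by simp
        from this[OF lim[OF x] lim[OF shift_torus[OF \<epsilon> x, of i]]] lim[OF less.prems(2)]
        show ?thesis by (simp add: average_def)
      qed
      finally show ?thesis .
    qed
  qed
qed

section \<open>Comparison of the process with the chain\<close>

lemma poisson_grid_of_iid:
  fixes N :: "'k \<Rightarrow> real \<Rightarrow> 'w \<Rightarrow> nat"
  assumes "prob_space M" and iid: "iid_poisson_processes M r K N"
    and K: "finite K" "K \<noteq> {}" and "0 < r" "0 < h" "0 < n"
  shows "poisson_grid M K (\<lambda>e k \<omega>. N e (real (Suc k) * h) \<omega> - N e (real k * h) \<omega>) n (r * h)"
proof -
  interpret prob_space M by fact
  let ?X = "\<lambda>e k \<omega>. N e (real (Suc k) * h) \<omega> - N e (real k * h) \<omega>"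
  let ?path = "\<lambda>e \<omega>. \<lambda>t\<in>{0..}. N e t \<omega>"
  have proc: "poisson_process M r (N e)" if "e \<in> K" for e
    using iid that by (simp add: iid_poisson_processes_def)
  have pos: "0 \<le> real k * h" for k using \<open>0 < h\<close> by simp
  have "indep_vars (\<lambda>_. count_space UNIV) (\<lambda>(e, k). ?X e k) (K \<times> {..<n})"
  proof (rule indep_vars_pairs)
    show "indep_vars (\<lambda>_. count_space UNIV) (?X e) {..<n}" if "e \<in> K" for e
    proof -
      have "mono (\<lambda>k. real k * h)" using \<open>0 < h\<close> by (intro monoI mult_right_mono) auto
      then show ?thesis
        using proc[OF that] unfolding poisson_process_def by (elim conjE allE[of _ n] allE[of _ "\<lambda>k. real k * h"]) auto
    qed
    fix A :: "'k \<Rightarrow> nat \<Rightarrow> nat set"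
    \<comment> \<open>For different edges only whole paths are known to be independent, so the event
      is phrased as a predicate on the path space reading finitely many grid times; within one edge,
      independence of increments is used.\<close>
    let ?Y = "\<lambda>e f. \<forall>k<n. f (real (Suc k) * h) - f (real k * h) \<in> A e k"
    have Y: "?Y e \<in> measurable (\<Pi>\<^sub>M t\<in>{0..}. count_space (UNIV :: nat set)) (count_space UNIV)" for e
    proof -
      have comp [measurable]: "(\<lambda>f. f (real k * h)) \<in>
          measurable (\<Pi>\<^sub>M t\<in>{0..}. count_space (UNIV :: nat set)) (count_space UNIV)" for k
        by (rule measurable_component_singleton) (use pos in auto)
      have "(\<lambda>f. f (real (Suc k) * h) - f (real k * h)) \<in>
          measurable (\<Pi>\<^sub>M t\<in>{0..}. count_space (UNIV :: nat set)) (count_space UNIV)" for k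
        by (rule measurable_compose_countable[OF _ comp[of k]],
            rule measurable_compose[OF comp[of "Suc k"]]) simp
      note [measurable] = this
      show ?thesis by measurable
    qed
    have "indep_vars (\<lambda>_. count_space UNIV) (\<lambda>e \<omega>. ?Y e (?path e \<omega>)) K"
      by (rule indep_vars_compose2[OF iid[unfolded iid_poisson_processes_def, THEN conjunct2] Y])
    from indep_varsD_finite[OF this K(2,1), of "\<lambda>_. {True}"]
    have "prob (\<Inter>e\<in>K. (\<lambda>\<omega>. ?Y e (?path e \<omega>)) -` {True} \<inter> space M)
        = (\<Prod>e\<in>K. prob ((\<lambda>\<omega>. ?Y e (?path e \<omega>)) -` {True} \<inter> space M))"
      by simp
    moreover have "(\<lambda>\<omega>. ?Y e (?path e \<omega>)) -` {True} \<inter> space M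
        = {\<omega>\<in>space M. \<forall>k\<in>{..<n}. ?X e k \<omega> \<in> A e k}" for e
      using pos by (auto simp del: of_nat_Suc)
    ultimately show "prob (\<Inter>e\<in>K. {\<omega>\<in>space M. \<forall>k\<in>{..<n}. ?X e k \<omega> \<in> A e k})
        = (\<Prod>e\<in>K. prob {\<omega>\<in>space M. \<forall>k\<in>{..<n}. ?X e k \<omega> \<in> A e k})"
      by (simp only:)
  qed (use K \<open>0 < n\<close> in auto)
  moreover have "distr M (count_space UNIV) (?X e k) = measure_pmf (poisson_pmf (r * h))" if "e \<in> K" for e k
  proof -
    have "distr M (count_space UNIV) (?X e k)
        = measure_pmf (poisson_pmf (r * (real (Suc k) * h - real k * h)))"
      using proc[OF that] pos[of k] \<open>0 < h\<close> unfolding poisson_process_def by simp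
    also have "real (Suc k) * h - real k * h = h" by (simp add: algebra_simps)
    finally show ?thesis .
  qed
  ultimately show ?thesis
    using K \<open>0 < r\<close> \<open>0 < h\<close> by unfold_locales auto
qed

section \<open>The chain along a history of choices\<close>

context edge_averaging
begin

definition run :: "('v \<Rightarrow> real) \<Rightarrow> ('v \<times> 'i) option list \<Rightarrow> 'v \<Rightarrow> real" where
  "run h l = foldl (\<lambda>h c. case c of None \<Rightarrow> h | Some e \<Rightarrow> avg e h) h l"

lemma run_simps [simp]:
  "run h [] = h" "run h (l @ [None]) = run h l" "run h (l @ [Some e]) = avg e (run h l)"
  by (simp_all add: run_def)

lemma run_sup:
  assumes "set l \<subseteq> insert None (Some ` edges)" and "\<And>x. x \<in> V \<Longrightarrow> \<bar>h x\<bar> \<le> B" and "x \<in> V"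
  shows "\<bar>run h l x\<bar> \<le> B"
  using assms(1,3)
proof (induction l arbitrary: x rule: rev_induct)
  case (snoc c l)
  then show ?case by (cases c) (auto intro!: avg_sup)
qed (use assms in simp)

lemma avg_cong:
  assumes "\<And>x. x \<in> V \<Longrightarrow> h x = g x" and "e \<in> edges" "y \<in> V"
  shows "avg e h y = avg e g y"
  using assms tgt_V by (auto simp: avg_def dif_def)

text \<open>Both recursions peel off the last step: the history appends the latest choice, and the
  chain applies the latest step to \<open>\<Phi>\<close>. Hence the induction with
  \<open>\<Phi>\<close> arbitrary.\<close>

lemma expectation_run:
  assumes "poisson_grid M edges X n \<mu>" and "k \<le> n"
  shows "(\<integral>\<omega>. \<Phi> (run u (poisson_grid.hist edges X k \<omega>)) (run v (poisson_grid.hist edges X k \<omega>)) \<partial>M)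
    = chain (poisson_grid.p edges \<mu>) k \<Phi> u v"
proof -
  interpret poisson_grid M edges X n \<mu> by fact
  show ?thesis using \<open>k \<le> n\<close>
  proof (induction k arbitrary: \<Phi>)
    case 0
    then show ?case by (simp add: hist_def prob_space)
  next
    case (Suc k)
    have "chain p k (\<lambda>u v. \<Sum>e\<in>edges. \<Phi> (avg e u) (avg e v)) u v
        = (\<Sum>e\<in>edges. chain p k (\<lambda>u v. \<Phi> (avg e u) (avg e v)) u v)"
      using chain_sum[OF finite_edges, where c = "\<lambda>_. 1" and \<Phi> = "\<lambda>e u v. \<Phi> (avg e u) (avg e v)"]
      by simp
    then have "chain p (Suc k) \<Phi> u v = (1 - nedges * p) * chain p k \<Phi> u v
        + p * (\<Sum>e\<in>edges. chain p k (\<lambda>u v. \<Phi> (avg e u) (avg e v)) u v)"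
      by (simp add: chain_step_def[abs_def] chain_add chain_scale)
    then show ?case
      using expectation_hist_Suc[of k "\<lambda>l. \<Phi> (run u l) (run v l)"] Suc
        Suc.IH[of "\<lambda>u v. \<Phi> (avg _ u) (avg _ v)"]
      by (simp add: nedges_def)
  qed
qed

end

lemma average_eq_avg:
  fixes V :: "(real ^ 'd) set" and h :: "real ^ 'd \<Rightarrow> real"
  assumes "edge_averaging V (shift \<epsilon>) tr orig"
  shows "average \<epsilon> i x h = edge_averaging.avg (shift \<epsilon>) (x, i) h"
proof -
  interpret edge_averaging V "shift \<epsilon>" tr orig by fact
  show ?thesis
    unfolding avg_def dif_def dip_def tgt_def
    by (auto simp: fun_eq_iff average_def field_simps)
qed

section \<open>Coupling of the process with the chain\<close>

context
  fixes \<epsilon> t :: real and M :: "'w measure"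
    and N :: "(real ^ 'd) \<times> 'd \<Rightarrow> real \<Rightarrow> 'w \<Rightarrow> nat" and n :: nat
  assumes \<epsilon>: "0 < \<epsilon>" "1 / \<epsilon> \<in> \<nat>" and M: "prob_space M"
    and iid: "iid_poisson_processes M (1 / \<epsilon>\<^sup>2) (torus \<epsilon> \<times> UNIV) N"
    and t: "t > 0" and n: "n > 0"
begin

interpretation edge_averaging "torus \<epsilon> :: (real ^ 'd) set" "shift \<epsilon>" translate 0
  by (rule edge_averaging_torus[OF \<epsilon>])

interpretation prob_space M by (rule M)

abbreviation "step \<equiv> t / n"

definition "incr e k \<omega> = N e (real (Suc k) * step) \<omega> - N e (real k * step) \<omega>"

interpretation poisson_grid M edges incr n "1 / \<epsilon>\<^sup>2 * step"
  unfolding incr_def[abs_def]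
  by (rule poisson_grid_of_iid[OF M iid]) (use finite_edges orig_V \<epsilon> t n in auto)

text \<open>At most one arrival over all edges together, so that the choice for the interval records
  every averaging performed in it.\<close>

definition "calm_at k \<omega> \<longleftrightarrow> (\<forall>e\<in>edges. incr e k \<omega> = 0)
  \<or> (\<exists>e\<in>edges. \<forall>e'\<in>edges. incr e' k \<omega> = of_bool (e' = e))"

definition "calm = {\<omega>\<in>space M. \<forall>k<n. calm_at k \<omega>}"

lemma prob_not_calm:
  "space M - calm \<in> events" "prob (space M - calm) \<le> n * (nedges * (1 / \<epsilon>\<^sup>2 * step))\<^sup>2"
proof -
  define B where "B k = {\<omega>\<in>space M. \<not> calm_at k \<omega>}" for k
  have B: "B k \<in> events" if "k < n" for k
  proof -
    have meas: "{\<omega>\<in>space M. \<forall>e\<in>edges. incr e k \<omega> = a e} \<in> events" for a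
    proof (rule sets.sets_Collect_finite_All[OF _ finite_edges])
      fix e assume "e \<in> edges"
      from measurable_sets[OF measurable_X[OF this that], of "{a e}"]
      show "{\<omega>\<in>space M. incr e k \<omega> = a e} \<in> events"
        by (rule back_subst[of "\<lambda>A. A \<in> events"]) auto
    qed
    show ?thesis unfolding B_def calm_at_def
      by (intro sets.sets_Collect_neg sets.sets_Collect_disj meas
          sets.sets_Collect_finite_Ex[OF _ finite_edges])
  qed
  have eq: "space M - calm = (\<Union>k<n. B k)" by (auto simp: calm_def B_def)
  then show "space M - calm \<in> events" using B by auto
  have "prob (\<Union>k<n. B k) \<le> (\<Sum>k<n. prob (B k))"
    by (rule finite_measure_subadditive_finite) (use B in auto)
  also have "\<dots> \<le> (\<Sum>k<n. (nedges * (1 / \<epsilon>\<^sup>2 * step))\<^sup>2)"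
    unfolding B_def calm_at_def nedges_def by (intro sum_mono prob_multiple_arrivals) auto
  finally show "prob (space M - calm) \<le> n * (nedges * (1 / \<epsilon>\<^sup>2 * step))\<^sup>2"
    by (simp add: eq)
qed

text \<open>On \<open>calm\<close> the choices omit no averaging, and the exact arrival time within
  an interval does not affect the value at its end. Process and chain therefore agree at all grid
  times.\<close>

lemma calm_path:
  fixes u0 :: "real ^ 'd \<Rightarrow> real"
  assumes path: "averaging_path \<epsilon> (\<lambda>e t. N e t \<omega>) u0 u"
    and mono: "\<And>e. e \<in> edges \<Longrightarrow> mono_on {0..} (\<lambda>t. N e t \<omega>)"
    and cont: "\<And>e t. e \<in> edges \<Longrightarrow> 0 \<le> t \<Longrightarrow> continuous (at_right t) (\<lambda>s. N e s \<omega>)"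
    and calm: "\<omega> \<in> calm" and "k \<le> n" "y \<in> torus \<epsilon>"
  shows "u (real k * step) y = run u0 (hist k \<omega>) y"
  using \<open>k \<le> n\<close> \<open>y \<in> torus \<epsilon>\<close>
proof (induction k arbitrary: y)
  case 0
  then show ?case using path by (simp add: averaging_path_def hist_def)
next
  case (Suc k)
  let ?s = "real k * step" and ?r = "real (Suc k) * step"
  have s: "0 \<le> ?s" "?s < ?r" using t n by (auto simp: field_simps)
  have le: "N e ?s \<omega> \<le> N e ?r \<omega>" if "e \<in> edges" for e
    using mono_onD[OF mono[OF that], of ?s ?r] s by auto
  have none: "arrivals (\<lambda>t. N e t \<omega>) \<inter> {?s<..?r} = {}" if "e \<in> edges" "incr e k \<omega> = 0" for e
    by (rule arrivals_empty[OF mono[OF that(1)] s(1)]) (use le[OF that(1)] that(2) in \<open>simp add: incr_def\<close>)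
  have "(\<forall>e\<in>edges. incr e k \<omega> = 0) \<or> (\<exists>e\<in>edges. single (\<lambda>e. incr e k \<omega>) e)"
    using calm Suc.prems unfolding calm_def calm_at_def single_def by auto
  then show ?case
  proof
    assume zero: "\<forall>e\<in>edges. incr e k \<omega> = 0"
    have "C k \<omega> = None"
    proof (cases "C k \<omega>")
      case (Some e)
      then have "single (\<lambda>e. incr e k \<omega>) e" by (simp only: C_def choice_eq_Some)
      then have "e \<in> edges" "incr e k \<omega> = 1" unfolding single_def by auto
      then show ?thesis using zero by (metis zero_neq_one)
    qed
    then have "run u0 (hist (Suc k) \<omega>) y = run u0 (hist k \<omega>) y" by (simp add: hist_Suc)
    also have "\<dots> = u ?s y" using Suc by simp
    also have "\<dots> = u ?r y"
      by (rule averaging_path_rest[OF path s(1) less_imp_le[OF s(2)] none Suc.prems(2), symmetric])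
        (use zero in auto)
    finally show ?thesis by simp
  next
    assume "\<exists>e\<in>edges. single (\<lambda>e. incr e k \<omega>) e"
    then obtain x i where e: "(x, i) \<in> edges" and single: "single (\<lambda>e. incr e k \<omega>) (x, i)"
      by auto
    then have C: "C k \<omega> = Some (x, i)" by (simp only: C_def choice_eq_Some)
    have incr: "incr e' k \<omega> = of_bool (e' = (x, i))" if "e' \<in> edges" for e'
      using single that unfolding single_def by blast
    have "N (x, i) ?r \<omega> = Suc (N (x, i) ?s \<omega>)"
      using incr[OF e] by (simp add: incr_def)
    from arrivals_single[OF mono[OF e] cont[OF e] s this]
    obtain \<tau> where \<tau>: "?s < \<tau>" "\<tau> \<le> ?r" "arrivals (\<lambda>t. N (x, i) t \<omega>) \<inter> {?s<..?r} = {\<tau>}"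
      by blast
    have "u ?r y = average \<epsilon> i x (u ?s) y"
      by (rule averaging_path_single[OF \<epsilon> path s(1) \<tau>(1,2) _ \<tau>(3) none Suc.prems(2)])
        (use e incr in auto)
    also have "\<dots> = avg (x, i) (u ?s) y"
      by (simp add: average_eq_avg[OF edge_averaging_torus[OF \<epsilon>]])
    also have "\<dots> = avg (x, i) (run u0 (hist k \<omega>)) y"
      by (rule avg_cong[OF Suc.IH e Suc.prems(2)]) (use Suc.prems in auto)
    also have "\<dots> = run u0 (hist (Suc k) \<omega>) y" by (simp add: hist_Suc C)
    finally show ?thesis .
  qed
qed

lemma AE_paths:
  fixes u0 :: "real ^ 'd \<Rightarrow> real"
  assumes proc: "averaging_process M \<epsilon> N u0 u" and B: "\<And>x. x \<in> torus \<epsilon> \<Longrightarrow> \<bar>u0 x\<bar> \<le> B"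
  shows "AE \<omega> in M. (\<forall>x\<in>torus \<epsilon>. \<bar>u t \<omega> x\<bar> \<le> B)
    \<and> (\<omega> \<in> calm \<longrightarrow> (\<forall>x\<in>torus \<epsilon>. u t \<omega> x = run u0 (hist n \<omega>) x))"
proof -
  have "AE \<omega> in M. \<forall>e\<in>edges. mono_on {0..} (\<lambda>t. N e t \<omega>)
      \<and> (\<forall>t\<ge>0. continuous (at_right t) (\<lambda>s. N e s \<omega>))"
    using iid
    by (subst AE_finite_all[OF finite_edges])
      (auto simp: iid_poisson_processes_def poisson_process_def elim!: eventually_mono)
  moreover have "AE \<omega> in M. averaging_path \<epsilon> (\<lambda>e t. N e t \<omega>) u0 (\<lambda>t. u t \<omega>)"
    using proc by (simp add: averaging_process_def)
  ultimately show ?thesis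
  proof eventually_elim
    case (elim \<omega>)
    note mono = bspec[OF elim(1), THEN conjunct1]
      and cont = bspec[OF elim(1), THEN conjunct2, rule_format]
    have nt: "real n * step = t" using n by simp
    show ?case
    proof (intro conjI ballI impI)
      fix x :: "real ^ 'd" assume x: "x \<in> torus \<epsilon>"
      show "\<bar>u t \<omega> x\<bar> \<le> B"
        by (rule averaging_path_bound[OF \<epsilon> elim(2) _ B _ x]) (use mono t in auto)
      assume "\<omega> \<in> calm"
      from calm_path[OF elim(2) mono cont this order.refl x]
      show "u t \<omega> x = run u0 (hist n \<omega>) x" unfolding nt .
    qed
  qed
qed

text \<open>The products for the process and for the chain agree almost surely on
  \<open>calm\<close>, and each is at most \<open>4 * A * B\<close> in absolute value almost surely.
  So the means differ by at most \<open>8 * A * B\<close> times the probability that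
  \<open>calm\<close> fails.\<close>

lemma expectation_dif_approx:
  fixes u0 v0 :: "real ^ 'd \<Rightarrow> real"
  assumes u: "averaging_process M \<epsilon> N u0 u" and A: "\<And>x. x \<in> torus \<epsilon> \<Longrightarrow> \<bar>u0 x\<bar> \<le> A"
    and v: "averaging_process M \<epsilon> N v0 v" and B: "\<And>x. x \<in> torus \<epsilon> \<Longrightarrow> \<bar>v0 x\<bar> \<le> B"
    and e: "e \<in> edges"
  shows "\<bar>expectation (\<lambda>\<omega>. dif e (u t \<omega>) * dif e (v t \<omega>))\<bar>
    \<le> \<bar>corr p n u0 v0 e\<bar> + 8 * A * B * (n * (nedges * (1 / \<epsilon>\<^sup>2 * step))\<^sup>2)"
proof -
  define f where "f \<omega> = dif e (u t \<omega>) * dif e (v t \<omega>)" for \<omega>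
  define g where "g \<omega> = dif e (run u0 (hist n \<omega>)) * dif e (run v0 (hist n \<omega>))" for \<omega>
  have A0: "0 \<le> A" using A[OF orig_V] by simp
  have prod_le: "\<bar>dif e h * dif e k\<bar> \<le> 4 * A * B"
    if "\<And>x. x \<in> torus \<epsilon> \<Longrightarrow> \<bar>h x\<bar> \<le> A" "\<And>x. x \<in> torus \<epsilon> \<Longrightarrow> \<bar>k x\<bar> \<le> B" for h k
  proof -
    have "\<bar>dif e h\<bar> \<le> 2 * A" "\<bar>dif e k\<bar> \<le> 2 * B"
      using that by (auto intro!: dif_sup[OF _ e])
    then have "\<bar>dif e h\<bar> * \<bar>dif e k\<bar> \<le> (2 * A) * (2 * B)"
      using A0 by (intro mult_mono) auto
    then show ?thesis by (simp add: abs_mult)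
  qed
  have hist_sub: "set (hist n \<omega>) \<subseteq> choices" for \<omega> using hist_in[of n \<omega>] by blast
  have g_le: "\<bar>g \<omega>\<bar> \<le> 4 * A * B" for \<omega>
    unfolding g_def by (rule prod_le) (use run_sup[OF hist_sub A] run_sup[OF hist_sub B] in auto)
  have AEu: "AE \<omega> in M. (\<forall>x\<in>torus \<epsilon>. \<bar>u t \<omega> x\<bar> \<le> A)
      \<and> (\<omega> \<in> calm \<longrightarrow> (\<forall>x\<in>torus \<epsilon>. u t \<omega> x = run u0 (hist n \<omega>) x))"
    by (rule AE_paths[OF u A])
  have AEv: "AE \<omega> in M. (\<forall>x\<in>torus \<epsilon>. \<bar>v t \<omega> x\<bar> \<le> B)
      \<and> (\<omega> \<in> calm \<longrightarrow> (\<forall>x\<in>torus \<epsilon>. v t \<omega> x = run v0 (hist n \<omega>) x))"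
    by (rule AE_paths[OF v B])
  have AE: "AE \<omega> in M. \<bar>f \<omega>\<bar> \<le> 4 * A * B \<and> (\<omega> \<in> calm \<longrightarrow> f \<omega> = g \<omega>)"
    using AEu AEv
  proof eventually_elim
    case (elim \<omega>)
    have "\<bar>f \<omega>\<bar> \<le> 4 * A * B" unfolding f_def by (rule prod_le) (use elim in auto)
    moreover have "f \<omega> = g \<omega>" if "\<omega> \<in> calm"
    proof -
      have "dif e (u t \<omega>) = dif e (run u0 (hist n \<omega>))" "dif e (v t \<omega>) = dif e (run v0 (hist n \<omega>))"
        unfolding dif_def using elim that e tgt_V[OF e] by auto
      then show ?thesis by (simp add: f_def g_def)
    qed
    ultimately show ?case by blast
  qed
  have "(\<lambda>\<omega>. u t \<omega> x) \<in> borel_measurable M" "(\<lambda>\<omega>. v t \<omega> x) \<in> borel_measurable M"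
    if "x \<in> torus \<epsilon>" for x
    using u v that t unfolding averaging_process_def by auto
  then have f_meas: "f \<in> borel_measurable M"
    using e tgt_V[OF e] unfolding f_def dif_def by (intro borel_measurable_times borel_measurable_diff) auto
  have g_meas: "g \<in> borel_measurable M"
    unfolding g_def by (rule measurable_hist) simp
  have f_int: "integrable M f"
    by (rule integrable_const_bound[where B = "4 * A * B"]) (use AE f_meas in auto)
  have g_int: "integrable M g"
    by (rule integrable_const_bound[where B = "4 * A * B"]) (use g_le g_meas in auto)
  have "\<bar>expectation f - expectation g\<bar> = \<bar>expectation (\<lambda>\<omega>. f \<omega> - g \<omega>)\<bar>"
    using f_int g_int by simp
  also have "\<dots> \<le> expectation (\<lambda>\<omega>. 8 * A * B * indicator (space M - calm) \<omega>)"
  proof (rule order.trans[OF integral_abs_bound integral_mono_AE])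
    show "AE \<omega> in M. \<bar>f \<omega> - g \<omega>\<bar> \<le> 8 * A * B * indicator (space M - calm) \<omega>"
      using AE AE_space
    proof eventually_elim
      case (elim \<omega>)
      have "\<bar>f \<omega> - g \<omega>\<bar> \<le> 8 * A * B" using elim(1) g_le[of \<omega>] by linarith
      then show ?case using elim by (auto simp: indicator_def)
    qed
  qed (use f_int g_int prob_not_calm(1) in \<open>auto simp: emeasure_eq_measure\<close>)
  also have "\<dots> = 8 * A * B * prob (space M - calm)"
    using prob_not_calm(1) by simp
  also have "\<dots> \<le> 8 * A * B * (n * (nedges * (1 / \<epsilon>\<^sup>2 * step))\<^sup>2)"
    using A0 B[OF orig_V] by (intro mult_left_mono prob_not_calm(2)) auto
  also have "expectation g = corr p n u0 v0 e"
    unfolding g_def corr_def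
    by (rule expectation_run[OF poisson_grid_axioms order.refl])
  finally show ?thesis unfolding f_def[abs_def] by linarith
qed

text \<open>Collects the errors of the Duhamel expansion and of the coupling, both of order
  \<open>1 / n\<close>. Here \<open>c\<close> is the expected number of arrivals up to time
  \<open>t\<close> over all edges; \<open>c < n\<close> yields \<open>nedges * p < 1\<close>, which
  the absorption requires.\<close>

lemma sum_expectation_dif_le:
  fixes u0 v0 :: "real ^ 'd \<Rightarrow> real"
  assumes u: "averaging_process M \<epsilon> N u0 u" and A: "\<And>x. x \<in> torus \<epsilon> \<Longrightarrow> \<bar>u0 x\<bar> \<le> A"
    and v: "averaging_process M \<epsilon> N v0 v" and B: "\<And>x. x \<in> torus \<epsilon> \<Longrightarrow> \<bar>v0 x\<bar> \<le> B"
    and G: "\<And>e. e \<in> edges \<Longrightarrow> \<bar>dif e u0\<bar> \<le> G"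
  defines "c \<equiv> nedges * t / \<epsilon>\<^sup>2"
  assumes c: "c < n"
  shows "(\<Sum>e\<in>edges. \<bar>expectation (\<lambda>\<omega>. dif e (u t \<omega>) * dif e (v t \<omega>))\<bar>)
    \<le> (G * (\<Sum>e\<in>edges. \<bar>dif e v0\<bar>) + 4 * nedges * c\<^sup>2 * A * B / n) * (1 + 1 / (1 - c / n))
      + 8 * nedges * c\<^sup>2 * A * B / n"
proof -
  define \<mu> where "\<mu> = 1 / \<epsilon>\<^sup>2 * step"
  have m\<mu>: "nedges * \<mu> = c / n" by (simp add: \<mu>_def c_def)
  have \<mu>: "0 < \<mu>" using mu_pos by (simp add: \<mu>_def)
  have m0: "0 \<le> nedges" by (rule nedges_nonneg)
  have A0: "0 \<le> A" and B0: "0 \<le> B" using A[OF orig_V] B[OF orig_V] by auto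
  have G0: "0 \<le> G" using G[of "(0, undefined)"] orig_V by auto
  have p: "p = \<mu> * exp (- (card edges * \<mu>))" unfolding p_def \<mu>_def ..
  have p0: "0 \<le> p" and p_le: "p \<le> \<mu>"
    using \<mu> m0 unfolding p by (auto simp: mult_le_cancel_left1)
  have mp: "nedges * p \<le> c / n"
    using p_le m0 by (simp flip: m\<mu> add: mult_left_mono)
  have c1: "c / n < 1" using c n by simp
  have frac_le: "(2 - nedges * p) / (1 - nedges * p) \<le> 1 + 1 / (1 - c / n)"
  proof -
    have "(2 - nedges * p) / (1 - nedges * p) = 1 + 1 / (1 - nedges * p)"
      using mp c1 by (simp add: field_simps)
    also have "\<dots> \<le> 1 + 1 / (1 - c / n)"
      using mp c1 by (intro add_left_mono divide_left_mono) auto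
    finally show ?thesis .
  qed
  have sq: "n * (nedges * \<mu>)\<^sup>2 = c\<^sup>2 / n"
    unfolding m\<mu> using n by (simp add: power2_eq_square)
  have "4 * real n * p\<^sup>2 * nedges ^ 3 * A * B \<le> 4 * real n * \<mu>\<^sup>2 * nedges ^ 3 * A * B"
    using p0 p_le m0 A0 B0 by (intro mult_right_mono mult_left_mono power_mono) auto
  also have "\<dots> = 4 * nedges * (n * (nedges * \<mu>)\<^sup>2) * A * B"
    by (simp add: power2_eq_square power3_eq_cube)
  finally have err: "4 * real n * p\<^sup>2 * nedges ^ 3 * A * B \<le> 4 * nedges * c\<^sup>2 * A * B / n"
    unfolding sq by simp
  have "(\<Sum>e\<in>edges. \<bar>expectation (\<lambda>\<omega>. dif e (u t \<omega>) * dif e (v t \<omega>))\<bar>)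
      \<le> (\<Sum>e\<in>edges. \<bar>corr p n u0 v0 e\<bar> + 8 * A * B * (n * (nedges * \<mu>)\<^sup>2))"
    unfolding \<mu>_def by (intro sum_mono expectation_dif_approx[OF u A v B])
  also have "\<dots> = (\<Sum>e\<in>edges. \<bar>corr p n u0 v0 e\<bar>) + 8 * nedges * c\<^sup>2 * A * B / n"
    unfolding sq by (simp add: sum.distrib nedges_def)
  also have "(\<Sum>e\<in>edges. \<bar>corr p n u0 v0 e\<bar>)
      \<le> (G * (\<Sum>e\<in>edges. \<bar>dif e v0\<bar>) + 4 * real n * p\<^sup>2 * nedges ^ 3 * A * B)
        * ((2 - nedges * p) / (1 - nedges * p))"
    by (rule sum_corr_le[OF p0 _ A B G]) (use mp c1 in auto)
  also have "\<dots> \<le> (G * (\<Sum>e\<in>edges. \<bar>dif e v0\<bar>) + 4 * nedges * c\<^sup>2 * A * B / n)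
        * (1 + 1 / (1 - c / n))"
  proof (rule mult_mono[OF add_left_mono[OF err] frac_le])
    show "0 \<le> G * (\<Sum>e\<in>edges. \<bar>dif e v0\<bar>) + 4 * nedges * c\<^sup>2 * A * B / n"
      using G0 m0 A0 B0 by (intro add_nonneg_nonneg mult_nonneg_nonneg divide_nonneg_nonneg sum_nonneg) auto
    show "0 \<le> (2 - nedges * p) / (1 - nedges * p)" using mp c1 by simp
  qed
  finally show ?thesis by simp
qed

end

section \<open>Letting the number of intervals tend to infinity\<close>

theorem lemma2p4:
  fixes \<epsilon> t :: real
    and M :: "'w measure"
    and N :: "(real ^ 'd) \<times> 'd \<Rightarrow> real \<Rightarrow> 'w \<Rightarrow> nat"
    and u0 v0 :: "real ^ 'd \<Rightarrow> real"
    and u v :: "real \<Rightarrow> 'w \<Rightarrow> real ^ 'd \<Rightarrow> real"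
  assumes "0 < \<epsilon>" and "\<epsilon> < 1" and "1 / \<epsilon> \<in> \<nat>"
    and "prob_space M"
    and "iid_poisson_processes M (1 / \<epsilon>\<^sup>2) (torus \<epsilon> \<times> UNIV) N"
    and "averaging_process M \<epsilon> N u0 u"
    and "averaging_process M \<epsilon> N v0 v"
    and "t > 0"
  shows "\<epsilon> ^ CARD('d) *
           (\<Sum>x\<in>torus \<epsilon>. \<Sum>j\<in>UNIV.
              \<bar>prob_space.expectation M (\<lambda>\<omega>. grad \<epsilon> j (u t \<omega>) x * grad \<epsilon> j (v t \<omega>) x)\<bar>)
         \<le> 2 * (MAX i\<in>UNIV. Linf_norm \<epsilon> (grad \<epsilon> i u0)) * (\<Sum>i\<in>UNIV. L1_norm \<epsilon> (grad \<epsilon> i v0))"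
proof -
  note \<epsilon> = assms(1,3)
  interpret edge_averaging "torus \<epsilon> :: (real ^ 'd) set" "shift \<epsilon>" translate 0
    by (rule edge_averaging_torus[OF \<epsilon>])
  \<comment> \<open>The maxima \<open>A\<close> and \<open>B\<close> enter only error terms that
    vanish in the limit, which leaves a bound in terms of gradients.\<close>
  define A where "A = Max ((\<lambda>x. \<bar>u0 x\<bar>) ` torus \<epsilon>)"
  define B where "B = Max ((\<lambda>x. \<bar>v0 x\<bar>) ` torus \<epsilon>)"
  define L where "L = (MAX i\<in>UNIV. Linf_norm \<epsilon> (grad \<epsilon> i u0))"
  define S where "S = (\<Sum>e\<in>edges. \<bar>\<integral>\<omega>. dif e (u t \<omega>) * dif e (v t \<omega>) \<partial>M\<bar>)"
  define T where "T = (\<Sum>e\<in>edges. \<bar>dif e v0\<bar>)"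
  define c where "c = nedges * t / \<epsilon>\<^sup>2"
  have grad: "grad \<epsilon> i h x = dif (x, i) h / \<epsilon>" for i h x
    by (simp add: grad_def dif_def tgt_def)
  have A: "\<bar>u0 x\<bar> \<le> A" if "x \<in> torus \<epsilon>" for x
    unfolding A_def using that finite_V by (intro Max_ge) auto
  have B: "\<bar>v0 x\<bar> \<le> B" if "x \<in> torus \<epsilon>" for x
    unfolding B_def using that finite_V by (intro Max_ge) auto
  have L: "\<bar>dif e u0\<bar> \<le> \<epsilon> * L" if "e \<in> edges" for e
  proof -
    obtain x i where e: "e = (x, i)" "x \<in> torus \<epsilon>" using \<open>e \<in> edges\<close> by auto
    have "\<bar>grad \<epsilon> i u0 x\<bar> \<le> Linf_norm \<epsilon> (grad \<epsilon> i u0)"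
      unfolding Linf_norm_def using e finite_V by (intro cSUP_upper bdd_above_finite) auto
    also have "\<dots> \<le> L" unfolding L_def by (intro Max_ge) auto
    finally show ?thesis using \<epsilon> by (simp add: e grad field_simps)
  qed
  \<comment> \<open>\<open>S\<close> does not depend on the number \<open>n\<close> of intervals, so
    it is bounded by the limit of the right-hand sides, where \<open>1 + 1 / (1 - c / n)\<close>
    tends to \<open>2\<close>.\<close>
  have "S \<le> 2 * (\<epsilon> * L) * T"
  proof (rule tendsto_lowerbound)
    show "eventually (\<lambda>n. S \<le> (\<epsilon> * L * T + 4 * nedges * c\<^sup>2 * A * B / real n)
        * (1 + 1 / (1 - c / real n)) + 8 * nedges * c\<^sup>2 * A * B / real n) sequentially"
      using eventually_gt_at_top[of "nat \<lceil>c\<rceil>"]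
    proof eventually_elim
      case (elim n)
      then have "0 < n" "c < real n" by linarith+
      then show ?case
        unfolding S_def T_def c_def
        by (intro sum_expectation_dif_le[OF \<epsilon> assms(4,5,8) _ assms(6) A assms(7) B L]) auto
    qed
    have div: "(\<lambda>n. a / real n) \<longlonglongrightarrow> 0" for a :: real
      by (rule lim_const_over_n)
    have "(\<lambda>n. (\<epsilon> * L * T + 4 * nedges * c\<^sup>2 * A * B / real n)
        * (1 + 1 / (1 - c / real n)) + 8 * nedges * c\<^sup>2 * A * B / real n)
      \<longlonglongrightarrow> (\<epsilon> * L * T + 0) * (1 + 1 / (1 - 0)) + 0"
      by (intro tendsto_intros div) auto
    then show "(\<lambda>n. (\<epsilon> * L * T + 4 * nedges * c\<^sup>2 * A * B / real n)
        * (1 + 1 / (1 - c / real n)) + 8 * nedges * c\<^sup>2 * A * B / real n)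
      \<longlonglongrightarrow> 2 * (\<epsilon> * L) * T"
      by (simp add: mult_ac)
  qed simp
  \<comment> \<open>The two gradients on the left account for \<open>\<epsilon>\<^sup>2\<close>; on
    the right one \<open>\<epsilon>\<close> cancels against \<open>\<epsilon> * L\<close>, and the
    other turns \<open>T\<close> into L1 norms of gradients.\<close>
  then have "\<epsilon> ^ CARD('d) / \<epsilon>\<^sup>2 * S \<le> \<epsilon> ^ CARD('d) / \<epsilon>\<^sup>2 * (2 * (\<epsilon> * L) * T)"
    using \<epsilon> by (intro mult_left_mono) auto
  also have "\<dots> = 2 * L * (\<epsilon> ^ CARD('d) * (T / \<epsilon>))"
    using \<epsilon> by (simp add: power2_eq_square)
  also have "\<epsilon> ^ CARD('d) * (T / \<epsilon>) = (\<Sum>i\<in>UNIV. L1_norm \<epsilon> (grad \<epsilon> i v0))"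
  proof -
    have "T = (\<Sum>i\<in>UNIV. \<Sum>x\<in>torus \<epsilon>. \<bar>dif (x, i) v0\<bar>)"
      unfolding T_def by (subst sum.swap) (simp add: sum.cartesian_product)
    then show ?thesis
      using \<epsilon> by (simp add: L1_norm_def grad sum_divide_distrib sum_distrib_left)
  qed
  also have "\<epsilon> ^ CARD('d) / \<epsilon>\<^sup>2 * S = \<epsilon> ^ CARD('d) *
      (\<Sum>x\<in>torus \<epsilon>. \<Sum>j\<in>UNIV. \<bar>\<integral>\<omega>. grad \<epsilon> j (u t \<omega>) x * grad \<epsilon> j (v t \<omega>) x \<partial>M\<bar>)"
  proof -
    have "S = (\<Sum>x\<in>torus \<epsilon>. \<Sum>j\<in>UNIV. \<bar>\<integral>\<omega>. dif (x, j) (u t \<omega>) * dif (x, j) (v t \<omega>) \<partial>M\<bar>)"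
      by (simp add: S_def sum.cartesian_product)
    then show ?thesis
      by (simp add: grad power2_eq_square sum_divide_distrib sum_distrib_left)
  qed
  finally show ?thesis unfolding L_def .
qed

end
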